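(* For every $(s,a)\in\mathcal S\times\mathcal A$ and every probability measure $P$ with $F_P\in\Gamma_F$, $$\bigl\|\mu^\pi(s,a)-\mathcal V(F_P)\bigr\|_{\mathcal H_\epsilon}\ \uparrow\ d_C\bigl(\mathcal Z^\pi(s,a),P\bigr)\qquad\text{as }\epsilon\downarrow0.$$ Equivalently, the family of regularised induced metrics $\{\tilde d_{\mathrm{Cr},\epsilon}\}_{\epsilon>0}$ converges monotonically to the intrinsic Cramér geometry on admissible return distributions.
   Context: MDP. $\mathcal S$ is the state space, $\mathcal A$ the action space, $\gamma\in(0,1)$ the discount factor, $\mathcal P(\cdot\mid s,a)$ a transition kernel on $\mathcal S$, $\mathcal R(s,a,s')\in\mathbb R$ a reward function, and $\pi$ a fixed stationary policy (stochastic kernel on $\mathcal A$ given $\mathcal S$). $\mathcal P^\pi(\cdot\mid s,a)$ is the law of $(s',a')$ obtained by sampling $s'\sim\mathcal P(\cdot\mid s,a)$ and then $a'\sim\pi(\cdot\mid s')$. $R(s,a)$ is the one-step reward random variable: sample $S'\sim\mathcal P(\cdot\mid s,a)$ and set $R(s,a)=\mathcal R(s,a,S')$. The policy-induced field is $\mathcal Z^\pi(s,a):=\mathrm{Law}\bigl(\sum_{k\ge0}\gamma^kR_k\bigr)$ where $(S_0,A_0)=(s,a)$, $S_{k+1}\sim\mathcal P(\cdot\mid S_k,A_k)$, $A_{k+1}\sim\pi(\cdot\mid S_{k+1})$, $R_k=\mathcal R(S_k,A_k,S_{k+1})$. CDF fields. $F_P$ is the cumulative distribution function (CDF) of a probability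 law $P$ on $\mathbb R$; $F_{\delta_0}(x)=\mathbf 1\{x\ge0\}$. $\Gamma_F$ is the set of CDFs $F$ with $F-F_{\delta_0}\in L^2(\mathbb R)$. Cramér distance: $d_C(P_1,P_2)=\|F_{P_1}-F_{P_2}\|_{L^2(\mathbb R)}$. A return-distribution field is a map $\mathcal Z$ assigning to each $(s,a)\in\mathcal S\times\mathcal A$ a probability law $\mathcal Z(s,a)$ on $\mathbb R$; its CDF field $F_{\mathcal Z}$ is $(s,a)\mapsto F_{\mathcal Z}(s,a):=F_{\mathcal Z(s,a)}$. $\mathcal X^{\mathrm{cdf}}$ is the set of CDF fields $F_{\mathcal Z}$ with $F_{\mathcal Z(s,a)}\in\Gamma_F$ for all $(s,a)$. Metric: $d_{\mathrm{Cr}}(F_{\mathcal Z_1},F_{\mathcal Z_2})=\sup_{(s,a)}\|F_{\mathcal Z_1(s,a)}-F_{\mathcal Z_2(s,a)}\|_{L^2(\mathbb R)}$. Standing assumptions: there exists $R_{\max}<\infty$ with $|R(s,a)|\le R_{\max}$ almost surely for all $(s,a)$; for any return-distribution field $\mathcal Z$ with $F_{\mathcal Z}\in\mathcal X^{\mathrm{cdf}}$ and each $x\in\mathbb R$, the map $(s,a)\mapsto \mathbb E_{(s',a')\sim\mathcal P^\pi(\cdot\mid s,a)}[F_{\mathcal Z(s',a')}(x)]$ is measurable; and $F_{\mathcal Z^\pi(s,a)}\in\Gamma_F$ for all $(s,a)$. Spectral transport. Fourier convention $\widehat f(\omega)=\frac1{\sqrt{2\pi}}\int f(x)e^{-i\omega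 x}dx$. For $\epsilon>0$, $\mathcal H_\epsilon$ is the Hilbert space of $f$ with $\|f\|^2_{\mathcal H_\epsilon}=\frac1{2\pi}\int\frac{|\widehat f(\omega)|^2}{\omega^2+\epsilon}d\omega<\infty$, identified through the Fourier transform with a weighted $L^2$ space. $\mathcal V:\Gamma_F\to\mathcal H_\epsilon$ is the injective map with $\widehat{\mathcal V(F)}(\omega)=-\sqrt{2\pi}\,i\omega\,\overline{\widehat{(F-F_{\delta_0})}(\omega)}$ (the formula does not depend on $\epsilon$). $\mathcal X^{\mathrm{spec}}$ is the set of measurable $\mu:\mathcal S\times\mathcal A\to\mathcal H_\epsilon$ with $\sup_{(s,a)}\|\mu(s,a)\|_{\mathcal H_\epsilon}<\infty$. $\mathbb V:\mathcal X^{\mathrm{cdf}}\to\mathcal X^{\mathrm{spec}}$ is the injective map $(\mathbb VF_{\mathcal Z})(s,a):=\mathcal V(F_{\mathcal Z(s,a)})$; $\mathcal X^{\mathrm{adm}}:=\mathrm{range}(\mathbb V)$, with inverse $\mathbb V^{-1}:\mathcal X^{\mathrm{adm}}\to\mathcal X^{\mathrm{cdf}}$. $\mu^\pi:=\mathbb V(F_{\mathcal Z^\pi})$, i.e. $\mu^\pi(s,a)=\mathcal V(F_{\mathcal Z^\pi(s,a)})$; it is the fixed point of the spectral Bellman operator. Metrics on $\mathcal X^{\mathrm{adm}}$. Regularised induced metric: $\tilde d_{\mathrm{Cr},\epsilon}(\mu_1,\mu_2):=\sup_{(s,a)}\|\mu_1(s,a)-\mu_2(s,a)\|_{\mathcal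 H_\epsilon}$. Intrinsic Cramér metric pulled back to $\mathcal X^{\mathrm{adm}}$: $\tilde d_{\mathrm{Cr}}(\mu_1,\mu_2):=d_{\mathrm{Cr}}(\mathbb V^{-1}\mu_1,\mathbb V^{-1}\mu_2)$. Monotone convergence of the family of metrics refers to $\tilde d_{\mathrm{Cr},\epsilon}(\mu_1,\mu_2)\uparrow\tilde d_{\mathrm{Cr}}(\mu_1,\mu_2)$ as $\epsilon\downarrow0$ for all $\mu_1,\mu_2\in\mathcal X^{\mathrm{adm}}$. The symbol $\uparrow$ means monotone nondecreasing convergence as $\epsilon$ decreases to $0$. *)

theory Defs
  imports "HOL-Probability.Probability"
begin

section \<open>Square-integrable functions and the Fourier transform on the real line\<close>

definition ennreal_sqrt :: "ennreal \<Rightarrow> ennreal" where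
  "ennreal_sqrt x = (if x = \<top> then \<top> else ennreal (sqrt (enn2real x)))"

(* Norms are extended-valued, so that finiteness of the norm is exactly membership in the space
   (for measurable functions) and no junk value arises for divergent integrals. *)

definition L2_norm :: "(real \<Rightarrow> 'b::real_normed_vector) \<Rightarrow> ennreal" where
  "L2_norm f = ennreal_sqrt (\<integral>\<^sup>+x. ennreal ((norm (f x))\<^sup>2) \<partial>lborel)"

definition in_L2 :: "(real \<Rightarrow> 'b::real_normed_vector) \<Rightarrow> bool" where
  "in_L2 f \<longleftrightarrow> f \<in> borel_measurable lborel \<and> L2_norm f < \<top>"

definition fourier_integral :: "(real \<Rightarrow> complex) \<Rightarrow> real \<Rightarrow> complex" where
  "fourier_integral f \<omega> =
     complex_of_real (1 / sqrt (2 * pi)) *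
     (LINT x|lborel. f x * exp (- (\<i> * complex_of_real (\<omega> * x))))"

(* A function in L^2 need not be integrable (the functions F - F_{delta_0} below need not be), so
   its transform is the limit in L^2 of the transforms of its truncations to [-R, R].
   It is determined up to a null set. *)

definition has_L2_fourier :: "(real \<Rightarrow> complex) \<Rightarrow> (real \<Rightarrow> complex) \<Rightarrow> bool" where
  "has_L2_fourier f g \<longleftrightarrow> in_L2 f \<and> in_L2 g \<and>
     ((\<lambda>R. L2_norm (\<lambda>\<omega>. g \<omega> - fourier_integral (\<lambda>x. indicat_real {-R..R} x *\<^sub>R f x) \<omega>))
        \<longlongrightarrow> 0) at_top"

definition L2_fourier :: "(real \<Rightarrow> complex) \<Rightarrow> real \<Rightarrow> complex" where
  "L2_fourier f = (SOME g. has_L2_fourier f g)"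


section \<open>The spaces \<open>\<H>\<^sub>\<epsilon>\<close>\<close>

(* An element f of H_eps is represented by its Fourier transform, a measurable function modulo
   null sets; all the spaces H_eps live inside this one quotient, and H_eps is the subspace of
   those h with Heps_norm eps h finite. *)

quotient_type spectral = "real \<Rightarrow> complex" / partial:
  "\<lambda>f g. f \<in> borel_measurable lborel \<and> g \<in> borel_measurable lborel \<and> (AE \<omega> in lborel. f \<omega> = g \<omega>)"
proof (rule part_equivpI)
  show "\<exists>f. f \<in> borel_measurable lborel \<and> f \<in> borel_measurable lborel \<and>
      (AE \<omega> in lborel. (f \<omega> :: complex) = f \<omega>)"
    by (intro exI[of _ "\<lambda>_. 0"]) simp
  show "symp (\<lambda>f g. f \<in> borel_measurable lborel \<and> g \<in> borel_measurable lborel \<and>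
      (AE \<omega> in lborel. (f \<omega> :: complex) = g \<omega>))"
    by (auto intro!: sympI simp: eq_commute)
  show "transp (\<lambda>f g. f \<in> borel_measurable lborel \<and> g \<in> borel_measurable lborel \<and>
      (AE \<omega> in lborel. (f \<omega> :: complex) = g \<omega>))"
    by (rule transpI) (use eventually_elim2 in fastforce)
qed

instantiation spectral :: minus
begin

lift_definition minus_spectral :: "spectral \<Rightarrow> spectral \<Rightarrow> spectral" is
  "\<lambda>f g \<omega>. f \<omega> - g \<omega>"
  by auto

instance ..

end

lift_definition Heps_norm :: "real \<Rightarrow> spectral \<Rightarrow> ennreal" is
  "\<lambda>\<epsilon> g. ennreal_sqrt
     (ennreal (1 / (2 * pi)) * (\<integral>\<^sup>+\<omega>. ennreal ((cmod (g \<omega>))\<^sup>2 / (\<omega>\<^sup>2 + \<epsilon>)) \<partial>lborel))"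
proof -
  fix \<epsilon> :: real and f g :: "real \<Rightarrow> complex"
  assume *: "f \<in> borel_measurable lborel \<and> g \<in> borel_measurable lborel \<and>
    (AE \<omega> in lborel. f \<omega> = g \<omega>)"
  have "(\<integral>\<^sup>+\<omega>. ennreal ((cmod (f \<omega>))\<^sup>2 / (\<omega>\<^sup>2 + \<epsilon>)) \<partial>lborel) =
        (\<integral>\<^sup>+\<omega>. ennreal ((cmod (g \<omega>))\<^sup>2 / (\<omega>\<^sup>2 + \<epsilon>)) \<partial>lborel)"
    using * by (intro nn_integral_cong_AE) (auto elim: eventually_mono)
  then show "ennreal_sqrt
     (ennreal (1 / (2 * pi)) * (\<integral>\<^sup>+\<omega>. ennreal ((cmod (f \<omega>))\<^sup>2 / (\<omega>\<^sup>2 + \<epsilon>)) \<partial>lborel)) =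
    ennreal_sqrt
     (ennreal (1 / (2 * pi)) * (\<integral>\<^sup>+\<omega>. ennreal ((cmod (g \<omega>))\<^sup>2 / (\<omega>\<^sup>2 + \<epsilon>)) \<partial>lborel))"
    by simp
qed


section \<open>CDFs, fields of CDFs and their spectral transport\<close>

abbreviation cdf_delta0 :: "real \<Rightarrow> real" where
  "cdf_delta0 \<equiv> cdf (return borel 0)"

lemma cdf_delta0_eq: "cdf_delta0 x = (if 0 \<le> x then 1 else 0)"
  by (simp add: cdf_def measure_return)

definition Gamma_F :: "(real \<Rightarrow> real) set" where
  "Gamma_F = {cdf P | P. real_distribution P \<and> in_L2 (\<lambda>x. cdf P x - cdf_delta0 x)}"

definition cramer_dist :: "real measure \<Rightarrow> real measure \<Rightarrow> ennreal" where
  "cramer_dist P Q = L2_norm (\<lambda>x. cdf P x - cdf Q x)"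

definition V_map :: "(real \<Rightarrow> real) \<Rightarrow> spectral" where
  "V_map F = abs_spectral (\<lambda>\<omega>. - complex_of_real (sqrt (2 * pi)) * \<i> * complex_of_real \<omega> *
     cnj (L2_fourier (\<lambda>x. complex_of_real (F x - cdf_delta0 x)) \<omega>))"

(* Below, D is the set of state-action pairs. Fields are extensional functions on D, so that
   equality of fields is equality on D. *)

definition cdf_field :: "'i set \<Rightarrow> ('i \<Rightarrow> real measure) \<Rightarrow> 'i \<Rightarrow> real \<Rightarrow> real" where
  "cdf_field D Z = restrict (\<lambda>sa. cdf (Z sa)) D"

definition X_cdf :: "'i set \<Rightarrow> ('i \<Rightarrow> real \<Rightarrow> real) set" where
  "X_cdf D = {cdf_field D Z | Z. \<forall>sa\<in>D. real_distribution (Z sa) \<and> cdf (Z sa) \<in> Gamma_F}"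

definition d_Cr :: "'i set \<Rightarrow> ('i \<Rightarrow> real \<Rightarrow> real) \<Rightarrow> ('i \<Rightarrow> real \<Rightarrow> real) \<Rightarrow> ennreal" where
  "d_Cr D F G = (SUP sa\<in>D. L2_norm (\<lambda>x. F sa x - G sa x))"

definition V_field :: "'i set \<Rightarrow> ('i \<Rightarrow> real \<Rightarrow> real) \<Rightarrow> 'i \<Rightarrow> spectral" where
  "V_field D F = restrict (\<lambda>sa. V_map (F sa)) D"

(* No uniform bound over D is imposed on fields, so the suprema defining the metrics may be infinite. *)

definition X_adm :: "'i set \<Rightarrow> ('i \<Rightarrow> spectral) set" where
  "X_adm D = V_field D ` X_cdf D"

definition V_field_inv :: "'i set \<Rightarrow> ('i \<Rightarrow> spectral) \<Rightarrow> 'i \<Rightarrow> real \<Rightarrow> real" where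
  "V_field_inv D = the_inv_into (X_cdf D) (V_field D)"

definition d_Cr_reg :: "'i set \<Rightarrow> real \<Rightarrow> ('i \<Rightarrow> spectral) \<Rightarrow> ('i \<Rightarrow> spectral) \<Rightarrow> ennreal" where
  "d_Cr_reg D \<epsilon> \<mu>\<^sub>1 \<mu>\<^sub>2 = (SUP sa\<in>D. Heps_norm \<epsilon> (\<mu>\<^sub>1 sa - \<mu>\<^sub>2 sa))"

definition d_Cr_adm :: "'i set \<Rightarrow> ('i \<Rightarrow> spectral) \<Rightarrow> ('i \<Rightarrow> spectral) \<Rightarrow> ennreal" where
  "d_Cr_adm D \<mu>\<^sub>1 \<mu>\<^sub>2 = d_Cr D (V_field_inv D \<mu>\<^sub>1) (V_field_inv D \<mu>\<^sub>2)"

definition increases_to_at_0 :: "(real \<Rightarrow> ennreal) \<Rightarrow> ennreal \<Rightarrow> bool" where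
  "increases_to_at_0 f l \<longleftrightarrow> antimono_on {0<..} f \<and> (f \<longlongrightarrow> l) (at_right 0)"


section \<open>Markov decision processes and the return distribution of a policy\<close>

locale mdp =
  fixes \<S> :: "'s measure" and \<A> :: "'a measure" and \<gamma> :: real
    and kern :: "'s \<times> 'a \<Rightarrow> 's measure"
    and rew :: "'s \<times> 'a \<Rightarrow> 's \<Rightarrow> real"
    and pol :: "'s \<Rightarrow> 'a measure"
  assumes discount: "0 < \<gamma>" "\<gamma> < 1"
    and kern_measurable [measurable]: "kern \<in> \<S> \<Otimes>\<^sub>M \<A> \<rightarrow>\<^sub>M prob_algebra \<S>"
    and rew_measurable [measurable]: "case_prod rew \<in> borel_measurable ((\<S> \<Otimes>\<^sub>M \<A>) \<Otimes>\<^sub>M \<S>)"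
    and pol_measurable [measurable]: "pol \<in> \<S> \<rightarrow>\<^sub>M prob_algebra \<A>"

definition pol_trans ::
  "'s measure \<Rightarrow> 'a measure \<Rightarrow> ('s \<times> 'a \<Rightarrow> 's measure) \<Rightarrow> ('s \<Rightarrow> 'a measure) \<Rightarrow>
   's \<times> 'a \<Rightarrow> ('s \<times> 'a) measure" where
  "pol_trans \<S> \<A> kern pol sa =
     kern sa \<bind> (\<lambda>s'. pol s' \<bind> (\<lambda>a'. return (\<S> \<Otimes>\<^sub>M \<A>) (s', a')))"

(* The Ionescu-Tulcea kernels: the n-th one gives the conditional law of (S_n, A_n) given
   (S_i, A_i) for i < n. *)

definition traj_kernel ::
  "'s measure \<Rightarrow> 'a measure \<Rightarrow> ('s \<times> 'a \<Rightarrow> 's measure) \<Rightarrow> ('s \<Rightarrow> 'a measure) \<Rightarrow>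
   's \<times> 'a \<Rightarrow> nat \<Rightarrow> (nat \<Rightarrow> 's \<times> 'a) \<Rightarrow> ('s \<times> 'a) measure" where
  "traj_kernel \<S> \<A> kern pol sa n h =
     (case n of 0 \<Rightarrow> return (\<S> \<Otimes>\<^sub>M \<A>) sa | Suc m \<Rightarrow> pol_trans \<S> \<A> kern pol (h m))"

definition traj_measure ::
  "'s measure \<Rightarrow> 'a measure \<Rightarrow> ('s \<times> 'a \<Rightarrow> 's measure) \<Rightarrow> ('s \<Rightarrow> 'a measure) \<Rightarrow>
   's \<times> 'a \<Rightarrow> (nat \<Rightarrow> 's \<times> 'a) measure" where
  "traj_measure \<S> \<A> kern pol sa =
     projective_family.lim UNIV
       (Ionescu_Tulcea.CI (traj_kernel \<S> \<A> kern pol sa) (\<lambda>_. \<S> \<Otimes>\<^sub>M \<A>))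
       (\<lambda>_. \<S> \<Otimes>\<^sub>M \<A>)"

definition return_law ::
  "'s measure \<Rightarrow> 'a measure \<Rightarrow> real \<Rightarrow> ('s \<times> 'a \<Rightarrow> 's measure) \<Rightarrow> ('s \<times> 'a \<Rightarrow> 's \<Rightarrow> real) \<Rightarrow>
   ('s \<Rightarrow> 'a measure) \<Rightarrow> 's \<times> 'a \<Rightarrow> real measure" where
  "return_law \<S> \<A> \<gamma> kern rew pol sa =
     distr (traj_measure \<S> \<A> kern pol sa) borel
       (\<lambda>h. \<Sum>k. \<gamma> ^ k * rew (h k) (fst (h (Suc k))))"

context mdp
begin

lemma pol_trans_measurable [measurable]:
  "pol_trans \<S> \<A> kern pol \<in> \<S> \<Otimes>\<^sub>M \<A> \<rightarrow>\<^sub>M prob_algebra (\<S> \<Otimes>\<^sub>M \<A>)"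
  unfolding pol_trans_def
proof (rule measurable_bind_prob_space2[OF kern_measurable], unfold case_prod_beta,
    rule measurable_bind_prob_space2)
  show "(\<lambda>p. pol (snd p)) \<in> (\<S> \<Otimes>\<^sub>M \<A>) \<Otimes>\<^sub>M \<S> \<rightarrow>\<^sub>M prob_algebra \<A>"
    by (rule measurable_compose[OF measurable_snd pol_measurable])
  show "(\<lambda>(p, a'). return (\<S> \<Otimes>\<^sub>M \<A>) (snd p, a')) \<in>
      ((\<S> \<Otimes>\<^sub>M \<A>) \<Otimes>\<^sub>M \<S>) \<Otimes>\<^sub>M \<A> \<rightarrow>\<^sub>M prob_algebra (\<S> \<Otimes>\<^sub>M \<A>)"
    unfolding case_prod_beta
    by (rule measurable_compose[OF _ measurable_return_prob_space]) measurable
qed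

lemma Ionescu_Tulcea_traj:
  assumes sa: "sa \<in> space (\<S> \<Otimes>\<^sub>M \<A>)"
  shows "Ionescu_Tulcea (traj_kernel \<S> \<A> kern pol sa) (\<lambda>_. \<S> \<Otimes>\<^sub>M \<A>)"
proof -
  have *: "traj_kernel \<S> \<A> kern pol sa i \<in>
      PiM {0..<i} (\<lambda>_. \<S> \<Otimes>\<^sub>M \<A>) \<rightarrow>\<^sub>M prob_algebra (\<S> \<Otimes>\<^sub>M \<A>)" for i
  proof (cases i)
    case 0
    then show ?thesis
      using sa unfolding traj_kernel_def
      by (simp add: space_prob_algebra prob_space_return)
  next
    case (Suc m)
    then have "(\<lambda>h. h m) \<in> PiM {0..<i} (\<lambda>_. \<S> \<Otimes>\<^sub>M \<A>) \<rightarrow>\<^sub>M \<S> \<Otimes>\<^sub>M \<A>"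
      by (intro measurable_component_singleton) auto
    from measurable_compose[OF this pol_trans_measurable] Suc show ?thesis
      unfolding traj_kernel_def by simp
  qed
  have "prob_space (traj_kernel \<S> \<A> kern pol sa i h)"
    if "h \<in> space (PiM {0..<i} (\<lambda>_. \<S> \<Otimes>\<^sub>M \<A>))" for i h
    using measurable_space[OF * that] unfolding space_prob_algebra by simp
  with measurable_prob_algebraD[OF *] show ?thesis
    by (rule Ionescu_Tulcea.intro)
qed

lemma real_distribution_return_law:
  assumes sa: "sa \<in> space (\<S> \<Otimes>\<^sub>M \<A>)"
  shows "real_distribution (return_law \<S> \<A> \<gamma> kern rew pol sa)"
proof -
  interpret Ionescu_Tulcea "traj_kernel \<S> \<A> kern pol sa" "\<lambda>_. \<S> \<Otimes>\<^sub>M \<A>"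
    by (rule Ionescu_Tulcea_traj[OF sa])
  have eq: "traj_measure \<S> \<A> kern pol sa = PF.lim"
    by (simp add: traj_measure_def)
  have ps: "prob_space PF.lim"
  proof
    have "emeasure PF.lim (PF.emb UNIV {} {\<lambda>_. undefined}) = emeasure (CI {}) {\<lambda>_. undefined}"
      by (rule lim) (simp_all add: sets_PiM_empty)
    also have "\<dots> = 1"
      using prob_space.emeasure_space_1[OF PF.prob_space_P[of "{}"]] PF.space_P[of "{}"]
    by (simp add: space_PiM_empty)
    also have "PF.emb UNIV {} {\<lambda>_. undefined} = space PF.lim"
      by (auto simp: prod_emb_def space_PiM restrict_def)
    finally show "emeasure PF.lim (space PF.lim) = 1" .
  qed
  have c: "(\<lambda>h. h k) \<in> PF.lim \<rightarrow>\<^sub>M \<S> \<Otimes>\<^sub>M \<A>" for k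
    by (subst measurable_cong_sets[OF PF.sets_lim refl], rule measurable_component_singleton) simp
  have m: "(\<lambda>h. rew (h k) (fst (h (Suc k)))) \<in> borel_measurable PF.lim" for k
  proof -
    have "(\<lambda>h. (h k, fst (h (Suc k)))) \<in> PF.lim \<rightarrow>\<^sub>M (\<S> \<Otimes>\<^sub>M \<A>) \<Otimes>\<^sub>M \<S>"
      by (intro measurable_Pair measurable_compose[OF c measurable_fst] c)
    from measurable_compose[OF this rew_measurable] show ?thesis by simp
  qed
  have "(\<lambda>h. \<Sum>k. \<gamma> ^ k * rew (h k) (fst (h (Suc k)))) \<in> borel_measurable PF.lim"
    using m by (intro borel_measurable_suminf borel_measurable_times) auto
  from prob_space.prob_space_distr[OF ps this] show ?thesis
    by (auto simp: return_law_def eq real_distribution_def real_distribution_axioms_def)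
qed

end

end

(* On the Fourier side the squared H_eps-norm of V(F) - V(G) is the integral of
   w^2 / (w^2 + eps) against the squared modulus of the L^2 transform of F - G. The weight increases
   to 1 as eps decreases to 0, so monotone convergence and Plancherel's theorem give the squared
   Cramer distance. Plancherel is needed only for bounded, almost everywhere continuous functions,
   where damping the transform by a Gaussian and dominated convergence suffice; Riesz-Fischer
   provides the L^2 limit of the transforms of the truncations. For fields, both the limit in eps
   and the metrics are suprema, which commute. The same limit shows that V is injective. *)

theory Submission
  imports Defs
begin

section \<open>The extended \<open>L\<^sup>2\<close> norm\<close>

text \<open>\<open>V_map\<close> is built on \<open>L2_fourier\<close>, a value picked by
  \<open>SOME\<close>. Nothing is known about it until some transform is shown to exist, and the
  value picked for a difference need not be the difference of the values picked. Linearity and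
  Plancherel are therefore stated for the relation \<open>has_L2_fourier\<close>, and Plancherel
  holds for every transform of the given function. The functions F - F_{delta_0} are bounded by 1
  and have only countably many discontinuities, but they jump and may fail to be integrable.
  Boundedness and almost everywhere continuity survive truncation and subtraction, so the argument
  never leaves this class. Norms live in \<open>ennreal\<close>, where divergent integrals are
  harmless but an error term cannot be freely moved across an inequality. Equalities of norms in a
  limit are thus proved as two triangle inequalities, each with a vanishing error added on the
  right. The constants are matched: the factor sqrt(2 pi) in \<open>V_map\<close> squares to the
  inverse of the 1/(2 pi) in \<open>Heps_norm\<close>, and conjugation and the factor -i leave the
  modulus unchanged.\<close>

text \<open>Adjunction between root and square on the extended half-line, infinity included. It
  reduces bounds on norms to bounds on integrals of squares.\<close>

lemma ennreal_sqrt_le_iff: "ennreal_sqrt x \<le> y \<longleftrightarrow> x \<le> y\<^sup>2"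
proof (cases "x = \<top> \<or> y = \<top>")
  case True
  then show ?thesis
    by (cases y) (auto simp: ennreal_sqrt_def top_unique ennreal_power split: if_splits)
next
  case False
  then obtain a b where "x = ennreal a" "y = ennreal b" "a \<ge> 0" "b \<ge> 0"
    by (metis ennreal_cases)
  then show ?thesis
    by (simp add: ennreal_sqrt_def ennreal_power real_sqrt_le_iff' real_le_lsqrt sqrt_le_D)
qed

lemma ennreal_sqrt_power2 [simp]: "(ennreal_sqrt x)\<^sup>2 = x"
  by (cases x) (auto simp: ennreal_sqrt_def ennreal_power)

lemma ennreal_sqrt_of_power2 [simp]: "ennreal_sqrt (x\<^sup>2) = x"
  by (cases x) (auto simp: ennreal_sqrt_def ennreal_power)

lemma ennreal_sqrt_mono: "x \<le> y \<Longrightarrow> ennreal_sqrt x \<le> ennreal_sqrt y"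
  by (simp add: ennreal_sqrt_le_iff)

lemma ennreal_sqrt_less_top_iff [simp]: "ennreal_sqrt x < \<top> \<longleftrightarrow> x < \<top>"
  by (cases x) (auto simp: ennreal_sqrt_def)

lemma L2_norm_power2: "(L2_norm f)\<^sup>2 = (\<integral>\<^sup>+x. ennreal ((norm (f x))\<^sup>2) \<partial>lborel)"
  by (simp add: L2_norm_def)

lemma L2_norm_eq_0_iff:
  assumes [measurable]: "f \<in> borel_measurable lborel"
  shows "L2_norm f = 0 \<longleftrightarrow> (AE x in lborel. f x = 0)"
proof -
  have "L2_norm f = 0 \<longleftrightarrow> (L2_norm f)\<^sup>2 = 0" by simp
  also have "\<dots> \<longleftrightarrow> (AE x in lborel. f x = 0)"
    unfolding L2_norm_power2 by (subst nn_integral_0_iff_AE) auto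
  finally show ?thesis .
qed

text \<open>Expand the square pointwise and bound the mixed term by Cauchy-Schwarz for nonnegative
  integrals. Either norm may be infinite.\<close>

lemma L2_norm_triangle:
  fixes f g :: "real \<Rightarrow> 'b::{real_normed_vector, second_countable_topology}"
  assumes [measurable]: "f \<in> borel_measurable lborel" "g \<in> borel_measurable lborel"
  shows "L2_norm (\<lambda>x. f x + g x) \<le> L2_norm f + L2_norm g"
proof -
  let ?F = "L2_norm f" and ?G = "L2_norm g"
  let ?I = "\<integral>\<^sup>+x. ennreal (norm (f x)) * ennreal (norm (g x)) \<partial>lborel"
  have "?I\<^sup>2 \<le> ?F\<^sup>2 * ?G\<^sup>2"
    using Cauchy_Schwarz_nn_integral[of "\<lambda>x. ennreal (norm (f x))" lborel "\<lambda>x. ennreal (norm (g x))"]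
    by (simp add: L2_norm_power2 ennreal_power)
  then have "ennreal_sqrt (?I\<^sup>2) \<le> ?F * ?G"
    unfolding ennreal_sqrt_le_iff by (simp add: power_mult_distrib)
  then have I: "?I \<le> ?F * ?G" by simp
  have "(\<integral>\<^sup>+x. ennreal ((norm (f x + g x))\<^sup>2) \<partial>lborel)
      \<le> (\<integral>\<^sup>+x. ennreal ((norm (f x))\<^sup>2)
           + 2 * (ennreal (norm (f x)) * ennreal (norm (g x))) + ennreal ((norm (g x))\<^sup>2) \<partial>lborel)"
  proof (rule nn_integral_mono)
    fix x
    have "(norm (f x + g x))\<^sup>2 \<le> (norm (f x) + norm (g x))\<^sup>2"
      by (intro power_mono norm_triangle_ineq) auto
    also have "\<dots> = (norm (f x))\<^sup>2 + 2 * (norm (f x) * norm (g x)) + (norm (g x))\<^sup>2"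
      by (simp add: power2_sum)
    finally show "ennreal ((norm (f x + g x))\<^sup>2) \<le> ennreal ((norm (f x))\<^sup>2)
           + 2 * (ennreal (norm (f x)) * ennreal (norm (g x))) + ennreal ((norm (g x))\<^sup>2)"
      by (simp add: ennreal_mult'[symmetric] ennreal_plus[symmetric] ennreal_leI
          flip: ennreal_numeral del: ennreal_plus)
  qed
  also have "\<dots> = ?F\<^sup>2 + 2 * ?I + ?G\<^sup>2"
    by (simp add: nn_integral_add nn_integral_cmult L2_norm_power2)
  also have "\<dots> \<le> ?F\<^sup>2 + 2 * (?F * ?G) + ?G\<^sup>2"
    by (intro add_mono mult_left_mono I) auto
  also have "\<dots> = (?F + ?G)\<^sup>2"
    by (simp add: power2_sum algebra_simps)
  finally show ?thesis
    unfolding L2_norm_def[of "\<lambda>x. f x + g x"] ennreal_sqrt_le_iff .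
qed

lemma L2_norm_minus [simp]: "L2_norm (\<lambda>x. - f x) = L2_norm f"
  by (simp add: L2_norm_def)

lemma L2_norm_triangle_diff:
  fixes f g :: "real \<Rightarrow> 'b::{real_normed_vector, second_countable_topology}"
  assumes "f \<in> borel_measurable lborel" "g \<in> borel_measurable lborel"
  shows "L2_norm (\<lambda>x. f x - g x) \<le> L2_norm f + L2_norm g"
  using L2_norm_triangle[of f "\<lambda>x. - g x"] assms by simp

text \<open>Riesz-Fischer for sequences that are Cauchy in the extended norm; only differences of
  members have to be small. A fast subsequence converges almost everywhere, and Fatou's lemma turns
  its pointwise limit into a limit in norm.\<close>

lemma L2_complete:
  fixes h :: "nat \<Rightarrow> real \<Rightarrow> 'b::{banach, second_countable_topology}"
  assumes [measurable]: "\<And>n. h n \<in> borel_measurable lborel"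
    and Cauchy: "\<And>e. e > 0 \<Longrightarrow> \<exists>N. \<forall>m\<ge>N. \<forall>n\<ge>N. L2_norm (\<lambda>x. h m x - h n x) \<le> ennreal e"
  obtains g where "g \<in> borel_measurable lborel" "(\<lambda>n. L2_norm (\<lambda>x. g x - h n x)) \<longlonglongrightarrow> 0"
proof -
  have "\<exists>N. \<forall>m\<ge>N. \<forall>n\<ge>N. L2_norm (\<lambda>x. h m x - h n x) \<le> ennreal ((1/4) ^ k)" for k :: nat
    by (rule Cauchy) simp
  then obtain N where N: "\<And>k m n. m \<ge> N k \<Longrightarrow> n \<ge> N k \<Longrightarrow>
      L2_norm (\<lambda>x. h m x - h n x) \<le> ennreal ((1/4) ^ k)"
    by metis
  \<comment> \<open>Partial sums of \<open>N\<close> lie above every earlier threshold, so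
    \<open>r j\<close> is admissible for all levels up to \<open>j\<close> although \<open>N\<close>
    need not be monotone.\<close>
  define r where "r k = (\<Sum>i\<le>k. N i)" for k
  have r: "N k \<le> r j" if "k \<le> j" for k j
    unfolding r_def using that by (intro member_le_sum) auto
  define d where "d k x = h (r (Suc k)) x - h (r k) x" for k x
  have [measurable]: "d k \<in> borel_measurable lborel" for k unfolding d_def[abs_def] by simp
  \<comment> \<open>The weight 4^k is affordable because the squared distances are at most 16^(-k).
    Finiteness of \<open>S x\<close> then forces geometric decay of \<open>d k x\<close> with ratio
    1/2, hence summability of the increments.\<close>
  define S where "S x = (\<Sum>k. ennreal (4 ^ k * (norm (d k x))\<^sup>2))" for x
  have [measurable]: "S \<in> borel_measurable lborel" unfolding S_def[abs_def] by measurable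
  have "(\<integral>\<^sup>+x. S x \<partial>lborel) = (\<Sum>k. \<integral>\<^sup>+x. ennreal (4 ^ k * (norm (d k x))\<^sup>2) \<partial>lborel)"
    unfolding S_def by (rule nn_integral_suminf) simp
  also have "\<dots> \<le> (\<Sum>k. ennreal ((1/4) ^ k))"
  proof (intro suminf_le)
    fix k
    have "(\<integral>\<^sup>+x. ennreal (4 ^ k * (norm (d k x))\<^sup>2) \<partial>lborel)
        = ennreal (4 ^ k) * (L2_norm (d k))\<^sup>2"
      by (simp add: ennreal_mult nn_integral_cmult L2_norm_power2)
    also have "\<dots> \<le> ennreal (4 ^ k) * (ennreal ((1/4) ^ k))\<^sup>2"
      unfolding d_def by (intro mult_left_mono power_mono N r) auto
    also have "\<dots> = ennreal ((1/4) ^ k)"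
      by (simp add: ennreal_power ennreal_mult[symmetric] power2_eq_square power_divide)
    finally show "(\<integral>\<^sup>+x. ennreal (4 ^ k * (norm (d k x))\<^sup>2) \<partial>lborel) \<le> ennreal ((1/4) ^ k)" .
  qed auto
  also have "\<dots> < \<top>"
    by (subst suminf_ennreal2) (auto intro!: summable_geometric)
  finally have "AE x in lborel. S x \<noteq> \<top>"
    using nn_integral_noteq_infinite[of S lborel] by simp
  then have conv: "AE x in lborel. convergent (\<lambda>k. h (r k) x)"
  proof eventually_elim
    fix x assume "S x \<noteq> \<top>"
    then obtain C where C: "S x = ennreal C" "C \<ge> 0" by (cases "S x") auto
    have d_le: "norm (d k x) \<le> sqrt C * (1/2) ^ k" for k
    proof -
      have "(\<Sum>k\<in>{k}. ennreal (4 ^ k * (norm (d k x))\<^sup>2)) \<le> S x"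
        unfolding S_def by (rule sum_le_suminf) (rule summableI, auto)
      then have "4 ^ k * (norm (d k x))\<^sup>2 \<le> C"
        unfolding C(1) using C(2) by (simp add: ennreal_le_iff)
      then have "(2 ^ k * norm (d k x))\<^sup>2 \<le> C"
        using power_mult_distrib[of 2 "2::real" k] by (simp add: power2_eq_square mult_ac)
      then have "2 ^ k * norm (d k x) \<le> sqrt C" by (rule real_le_rsqrt)
      then show ?thesis by (simp add: power_divide field_simps)
    qed
    have "summable (\<lambda>k. sqrt C * (1/2) ^ k)"
      by (intro summable_mult summable_geometric) simp
    then have "summable (\<lambda>k. d k x)"
      by (rule summable_comparison_test'[where N = 0]) (rule d_le)
    then have "convergent (\<lambda>n. \<Sum>k<n. d k x)" by (simp add: summable_iff_convergent)
    moreover have "(\<Sum>k<n. d k x) = h (r n) x - h (r 0) x" for n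
      unfolding d_def by (rule sum_lessThan_telescope)
    ultimately show "convergent (\<lambda>k. h (r k) x)"
      by (simp add: convergent_diff_const_right_iff)
  qed
  define g where "g x = lim (\<lambda>k. h (r k) x)" for x
  have [measurable]: "g \<in> borel_measurable lborel"
    unfolding g_def[abs_def] by measurable
  \<comment> \<open>With \<open>n\<close> fixed, Fatou is applied to the distances from
    \<open>h n\<close> along the subsequence, which eventually are all at most (1/4)^K. This gives a
    rate for the whole sequence.\<close>
  have bound: "L2_norm (\<lambda>x. g x - h n x) \<le> ennreal ((1/4) ^ K)" if n: "n \<ge> N K" for n K
  proof -
    have "(L2_norm (\<lambda>x. g x - h n x))\<^sup>2
        = (\<integral>\<^sup>+x. liminf (\<lambda>j. ennreal ((norm (h (r j) x - h n x))\<^sup>2)) \<partial>lborel)"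
      unfolding L2_norm_power2
    proof (rule nn_integral_cong_AE)
      show "AE x in lborel. ennreal ((norm (g x - h n x))\<^sup>2)
          = liminf (\<lambda>j. ennreal ((norm (h (r j) x - h n x))\<^sup>2))"
        using conv
      proof eventually_elim
        fix x assume "convergent (\<lambda>k. h (r k) x)"
        then have "(\<lambda>j. h (r j) x) \<longlonglongrightarrow> g x" by (simp add: g_def convergent_LIMSEQ_iff)
        then have "(\<lambda>j. ennreal ((norm (h (r j) x - h n x))\<^sup>2)) \<longlonglongrightarrow> ennreal ((norm (g x - h n x))\<^sup>2)"
          by (intro tendsto_intros)
        from lim_imp_Liminf[OF _ this]
        show "ennreal ((norm (g x - h n x))\<^sup>2) = liminf (\<lambda>j. ennreal ((norm (h (r j) x - h n x))\<^sup>2))"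
          by simp
      qed
    qed
    also have "\<dots> \<le> liminf (\<lambda>j. (L2_norm (\<lambda>x. h (r j) x - h n x))\<^sup>2)"
      unfolding L2_norm_power2 by (rule nn_integral_liminf) simp
    also have "\<dots> \<le> (ennreal ((1/4) ^ K))\<^sup>2"
    proof (rule Liminf_le)
      show "\<forall>\<^sub>F j in sequentially. (L2_norm (\<lambda>x. h (r j) x - h n x))\<^sup>2 \<le> (ennreal ((1/4) ^ K))\<^sup>2"
        using eventually_ge_at_top[of K]
        by eventually_elim (intro power_mono N r n, auto)
    qed simp
    finally have "ennreal_sqrt ((L2_norm (\<lambda>x. g x - h n x))\<^sup>2) \<le> ennreal ((1/4) ^ K)"
      unfolding ennreal_sqrt_le_iff .
    then show ?thesis by simp
  qed
  have "(\<lambda>n. L2_norm (\<lambda>x. g x - h n x)) \<longlonglongrightarrow> 0"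
  proof (rule order_tendstoI)
    fix a :: ennreal assume "0 < a"
    have "(\<lambda>K. ennreal ((1/4) ^ K)) \<longlonglongrightarrow> ennreal 0"
      by (intro tendsto_ennrealI LIMSEQ_power_zero) simp
    then have "\<forall>\<^sub>F K in sequentially. ennreal ((1/4) ^ K) < a"
      using \<open>0 < a\<close> by (intro order_tendstoD) auto
    then obtain K where "ennreal ((1/4) ^ K) < a"
      by (auto simp: eventually_sequentially)
    then show "\<forall>\<^sub>F n in sequentially. L2_norm (\<lambda>x. g x - h n x) < a"
      using bound[of K] by (auto simp: eventually_sequentially intro: le_less_trans)
  qed auto
  then show thesis by (rule that[rotated]) measurable
qed

section \<open>Plancherel theorem\<close>

text \<open>Fubini with majorant C * |f|, integrable on the product because \<open>N\<close> is
  finite. It serves once for a plain exponential kernel and once for an exponential multiplied by a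
  bounded transform.\<close>

lemma integral_parameter_swap:
  fixes f :: "'a \<Rightarrow> complex" and k :: "'u \<Rightarrow> 'a \<Rightarrow> complex"
  assumes "finite_measure N" "sigma_finite_measure M"
    and f [measurable]: "integrable M f"
    and k [measurable]: "case_prod k \<in> borel_measurable (N \<Otimes>\<^sub>M M)"
    and k_le: "\<And>u x. norm (k u x) \<le> C"
  shows "(LINT u|N. LINT x|M. f x * k u x) = (LINT x|M. f x * (LINT u|N. k u x))"
proof -
  interpret N: finite_measure N by fact
  interpret M: sigma_finite_measure M by fact
  interpret pair_sigma_finite N M ..
  have [measurable]: "f \<in> borel_measurable M" using f by auto
  have "integrable (N \<Otimes>\<^sub>M M) (\<lambda>(u, x). f x * k u x)"
  proof (rule Fubini_integrable)
    have le: "norm (f x * k u x) \<le> C * norm (f x)" for x u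
      using mult_left_mono[OF k_le[of u x] norm_ge_zero[of "f x"]] by (simp add: norm_mult mult.commute)
    have "AE u in N. norm (LINT x|M. norm (f x * k u x)) \<le> (LINT x|M. C * norm (f x))"
    proof (rule AE_I2)
      fix u assume "u \<in> space N"
      then have "integrable M (\<lambda>x. norm (f x * k u x))"
        by (intro Bochner_Integration.integrable_bound[OF integrable_mult_right[OF integrable_norm[OF f], of C]])
          (auto intro: order_trans[OF le abs_ge_self])
      then show "norm (LINT x|M. norm (f x * k u x)) \<le> (LINT x|M. C * norm (f x))"
        using le by (simp only: real_norm_def)
          (subst abs_of_nonneg, auto simp del: integral_mult_right_zero integral_mult_right
            intro!: integral_mono f integrable_norm integrable_mult_right)
    qed
    then show "integrable N (\<lambda>u. LINT x|M. norm (case (u, x) of (u, x) \<Rightarrow> f x * k u x))"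
      unfolding split
      by (rule N.integrable_const_bound) measurable
    show "AE u in N. integrable M (\<lambda>x. case (u, x) of (u, x) \<Rightarrow> f x * k u x)"
      unfolding split
      by (intro AE_I2 Bochner_Integration.integrable_bound[OF integrable_mult_right[OF integrable_norm[OF f], of C]])
          (auto intro: order_trans[OF le abs_ge_self])
  qed measurable
  from Fubini_integral[OF this] show ?thesis by simp
qed

lemma norm_exp_minus_ii [simp]: "norm (exp (- (\<i> * complex_of_real x))) = 1"
  using norm_exp_i_times[of "- x"] by simp

context
  fixes f :: "real \<Rightarrow> complex" and B :: real
  assumes f [measurable]: "integrable lborel f"
    and f_le: "\<And>x. norm (f x) \<le> B"
begin

private abbreviation "I \<omega> \<equiv> LINT x|lborel. f x * exp (- (\<i> * complex_of_real (\<omega> * x)))"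

private lemma f_measurable [measurable]: "f \<in> borel_measurable borel"
  using borel_measurable_integrable[OF f] by simp

private lemma B_nonneg: "0 \<le> B"
  using order_trans[OF norm_ge_zero f_le] .

private lemma I_le: "norm (I \<omega>) \<le> (LINT x|lborel. norm (f x))"
  by (rule order_trans[OF integral_norm_bound]) (simp add: norm_mult)

text \<open>Expanding the squared modulus and writing the Gaussian as the characteristic function of the standard normal
  law turns the damped integral into a Gaussian average of the autocorrelation of \<open>f\<close>.\<close>

lemma fourier_gaussian_weight:
  fixes \<sigma> :: real
  assumes "\<sigma> > 0"
  shows "(LINT \<omega>|lborel. complex_of_real ((norm (I \<omega>))\<^sup>2 * exp (- (\<sigma> * \<omega>)\<^sup>2 / 2))) =
    2 * pi * (LINT y|lborel. cnj (f y) * (LINT t|std_normal_distribution. f (y + \<sigma> * t)))"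
proof -
  let ?N = std_normal_distribution
  interpret N: real_distribution ?N by (rule real_dist_normal_dist)
  have fin: "finite_measure ?N" and sig: "sigma_finite_measure lborel"
    by unfold_locales
  \<comment> \<open>Passing between Lebesgue measure with the unnormalised Gaussian and the normal
    law costs the factor sqrt(2 pi).\<close>
  have dens: "(LINT u|lborel. g u * complex_of_real (exp (- u\<^sup>2 / 2))) = sqrt (2 * pi) * (LINT u|?N. g u)"
    if [measurable]: "g \<in> borel_measurable borel" for g :: "real \<Rightarrow> complex"
  proof -
    have "(LINT u|?N. g u) = (LINT u|lborel. std_normal_density u *\<^sub>R g u)"
      by (rule integral_density) auto
    also have "\<dots> = (LINT u|lborel. (1 / sqrt (2 * pi)) * (g u * complex_of_real (exp (- u\<^sup>2 / 2))))"
      by (simp add: std_normal_density_def scaleR_conv_of_real mult_ac)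
    also have "\<dots> = (1 / sqrt (2 * pi)) * (LINT u|lborel. g u * complex_of_real (exp (- u\<^sup>2 / 2)))"
      by (rule integral_mult_right_zero)
    finally show ?thesis by simp
  qed
  \<comment> \<open>The factors 1/\<sigma> and \<sigma> come from the two changes of variable. With
    s = sqrt(2 pi), the remaining s * s is the 2 pi of the claim.\<close>
  have scale: "complex_of_real (1 / \<sigma>) * (complex_of_real s * (complex_of_real (\<sigma> * s) * z)) = complex_of_real (s * s) * z" for s z
    using \<open>\<sigma> > 0\<close> by simp
  have cnj_f: "integrable lborel (\<lambda>y. cnj (f y))" using f by simp
  have Im [measurable]: "(\<lambda>u. I (u / \<sigma>)) \<in> borel_measurable borel"
    by measurable
  have Im2: "(\<lambda>u. I (u / \<sigma>) * cnj (I (u / \<sigma>))) \<in> borel_measurable borel"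
    by (intro borel_measurable_times Im measurable_compose[OF Im borel_measurable_continuous_onI[OF continuous_on_cnj[OF continuous_on_id]]])
  \<comment> \<open>Integrating over u first evaluates the normal characteristic function at (y -
    x)/\<sigma>, which is again a Gaussian; the substitution x = y + \<sigma> t turns the
    convolution with it into an average of \<open>f\<close> near \<open>y\<close>.\<close>
  have conv: "(LINT u|?N. exp (\<i> * complex_of_real (u / \<sigma> * y)) * I (u / \<sigma>)) =
      \<sigma> * sqrt (2 * pi) * (LINT t|?N. f (y + \<sigma> * t))" for y
  proof -
    have "(LINT u|?N. exp (\<i> * complex_of_real (u / \<sigma> * y)) * I (u / \<sigma>)) =
        (LINT u|?N. LINT x|lborel. f x * exp (\<i> * complex_of_real ((y - x) / \<sigma> * u)))"
      by (simp flip: integral_mult_right_zero)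
         (simp add: mult_exp_exp field_simps diff_divide_distrib)
    also have "\<dots> = (LINT x|lborel. f x * (LINT u|?N. exp (\<i> * complex_of_real ((y - x) / \<sigma> * u))))"
      by (rule integral_parameter_swap[OF fin sig f, where C = 1]) (auto simp del: of_real_mult of_real_divide)
    also have "\<dots> = (LINT x|lborel. f x * complex_of_real (exp (- ((y - x) / \<sigma>)\<^sup>2 / 2)))"
      using char_std_normal_distribution unfolding char_def fun_eq_iff by (simp only:)
    also have "\<dots> = \<sigma> * (LINT t|lborel. f (y + \<sigma> * t) * complex_of_real (exp (- t\<^sup>2 / 2)))"
      using \<open>\<sigma> > 0\<close>
      by (subst lborel_integral_real_affine[where c = \<sigma> and t = y]) (auto simp: scaleR_conv_of_real)
    also have "\<dots> = \<sigma> * sqrt (2 * pi) * (LINT t|?N. f (y + \<sigma> * t))"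
      by (subst dens) auto
    finally show ?thesis .
  qed
  \<comment> \<open>The substitution \<omega> = u/\<sigma> makes the damping factor independent of
    \<sigma>, so that \<open>dens\<close> applies.\<close>
  have "(LINT \<omega>|lborel. complex_of_real ((norm (I \<omega>))\<^sup>2 * exp (- (\<sigma> * \<omega>)\<^sup>2 / 2))) =
      (1 / \<sigma>) * (LINT u|lborel. I (u / \<sigma>) * cnj (I (u / \<sigma>)) * complex_of_real (exp (- u\<^sup>2 / 2)))"
    using \<open>\<sigma> > 0\<close>
    by (subst lborel_integral_real_affine[where c = "1 / \<sigma>" and t = 0])
      (auto simp: scaleR_conv_of_real complex_norm_square simp del: of_real_power)
  also have "\<dots> = (1 / \<sigma>) * (sqrt (2 * pi) * (LINT u|?N. I (u / \<sigma>) * cnj (I (u / \<sigma>))))"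
    by (simp only: dens[OF Im2])
  also have "(LINT u|?N. I (u / \<sigma>) * cnj (I (u / \<sigma>))) =
      (LINT u|?N. LINT y|lborel. cnj (f y) * (exp (\<i> * complex_of_real (u / \<sigma> * y)) * I (u / \<sigma>)))"
  proof (rule Bochner_Integration.integral_cong[OF refl])
    fix u
    have "cnj (I (u / \<sigma>)) = (LINT y|lborel. cnj (f y) * exp (\<i> * complex_of_real (u / \<sigma> * y)))"
      by (subst Bochner_Integration.integral_cnj[symmetric]) (simp add: exp_cnj)
    then show "I (u / \<sigma>) * cnj (I (u / \<sigma>)) =
        (LINT y|lborel. cnj (f y) * (exp (\<i> * complex_of_real (u / \<sigma> * y)) * I (u / \<sigma>)))"
      by (simp only: mult.assoc[symmetric] integral_mult_left_zero mult.commute)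
  qed
  also have "\<dots> = (LINT y|lborel. cnj (f y) * (LINT u|?N. exp (\<i> * complex_of_real (u / \<sigma> * y)) * I (u / \<sigma>)))"
  proof (rule integral_parameter_swap[OF fin sig cnj_f])
    show "norm (exp (\<i> * complex_of_real (u / \<sigma> * y)) * I (u / \<sigma>)) \<le> (LINT x|lborel. norm (f x))" for u y
      unfolding norm_mult norm_exp_i_times mult_1 by (rule I_le)
  qed measurable
  also have "\<dots> = \<sigma> * sqrt (2 * pi) * (LINT y|lborel. cnj (f y) * (LINT t|?N. f (y + \<sigma> * t)))"
    unfolding conv by (simp flip: integral_mult_right_zero) (simp add: algebra_simps)
  finally show ?thesis unfolding scale by simp
qed

text \<open>The damped integral is taken to the limit \<sigma> -> 0 in two ways: by monotone
  convergence in frequency, and by dominated convergence on the side of \<open>f\<close>. The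
  equality also shows that the transform is square integrable, which is not known
  beforehand.\<close>

lemma plancherel_integral:
  assumes cont: "AE x in lborel. isCont f x"
  shows "(\<integral>\<^sup>+\<omega>. ennreal ((norm (I \<omega>))\<^sup>2) \<partial>lborel) = ennreal (2 * pi) * (\<integral>\<^sup>+x. ennreal ((norm (f x))\<^sup>2) \<partial>lborel)"
proof -
  let ?N = std_normal_distribution
  interpret N: real_distribution ?N by (rule real_dist_normal_dist)
  have cnj: "cnj \<in> borel_measurable borel"
    by (intro borel_measurable_continuous_onI continuous_on_cnj continuous_on_id)
  define \<sigma> :: "nat \<Rightarrow> real" where "\<sigma> n = 1 / real (Suc n)" for n
  have \<sigma>: "\<sigma> n > 0" for n by (simp add: \<sigma>_def)
  have \<sigma>_0: "\<sigma> \<longlonglongrightarrow> 0"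
    unfolding \<sigma>_def[abs_def] using LIMSEQ_inverse_real_of_nat by (simp add: inverse_eq_divide)
  \<comment> \<open>This is where continuity enters: the Gaussian averages contract to the point
    \<open>y\<close>, and the bound \<open>B\<close> is integrable against the normal law.\<close>
  have inner: "(\<lambda>n. LINT t|?N. f (y + \<sigma> n * t)) \<longlonglongrightarrow> f y" if y: "isCont f y" for y
  proof -
    have "(\<lambda>n. LINT t|?N. f (y + \<sigma> n * t)) \<longlonglongrightarrow> (LINT t|?N. f y)"
    proof (rule integral_dominated_convergence[where w = "\<lambda>_. B"])
      show "AE t in ?N. (\<lambda>n. f (y + \<sigma> n * t)) \<longlonglongrightarrow> f y"
      proof (rule AE_I2)
        fix t
        have "(\<lambda>n. y + \<sigma> n * t) \<longlonglongrightarrow> y + 0 * t" by (intro tendsto_intros \<sigma>_0)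
        then show "(\<lambda>n. f (y + \<sigma> n * t)) \<longlonglongrightarrow> f y"
          using isCont_tendsto_compose[OF y] by simp
      qed
    qed (auto simp: f_le)
    then show ?thesis using N.prob_space by simp
  qed
  have "(\<lambda>n. LINT y|lborel. cnj (f y) * (LINT t|?N. f (y + \<sigma> n * t))) \<longlonglongrightarrow> (LINT y|lborel. cnj (f y) * f y)"
  proof (rule integral_dominated_convergence[where w = "\<lambda>y. B * norm (f y)"])
    show "AE y in lborel. (\<lambda>n. cnj (f y) * (LINT t|?N. f (y + \<sigma> n * t))) \<longlonglongrightarrow> cnj (f y) * f y"
      using cont by eventually_elim (intro tendsto_intros inner)
    fix n
    have m: "(\<lambda>y. LINT t|?N. f (y + \<sigma> n * t)) \<in> borel_measurable borel"
      by measurable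
    show "(\<lambda>y. cnj (f y) * (LINT t|?N. f (y + \<sigma> n * t))) \<in> borel_measurable lborel"
      using m measurable_compose[OF f_measurable cnj] by simp
    have "norm (LINT t|?N. f (y + \<sigma> n * t)) \<le> B" for y
    proof -
      have "norm (LINT t|?N. f (y + \<sigma> n * t)) \<le> (LINT t|?N. norm (f (y + \<sigma> n * t)))"
        by (rule integral_norm_bound)
      also have "\<dots> \<le> (LINT t|?N. B)"
        by (intro integral_mono N.integrable_const_bound[where B = B]) (auto simp: f_le B_nonneg)
      finally show ?thesis using N.prob_space by simp
    qed
    then have "norm (cnj (f y) * (LINT t|?N. f (y + \<sigma> n * t))) \<le> B * norm (f y)" for y
      unfolding norm_mult complex_mod_cnj by (subst mult.commute) (rule mult_right_mono, auto)
    then show "AE y in lborel. norm (cnj (f y) * (LINT t|?N. f (y + \<sigma> n * t))) \<le> B * norm (f y)"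
      by (intro AE_I2)
  qed (use f cnj in \<open>auto simp: measurable_compose[OF f_measurable]\<close>)
  also have "(LINT y|lborel. cnj (f y) * f y) = complex_of_real (LINT y|lborel. (norm (f y))\<^sup>2)"
    by (subst integral_complex_of_real[symmetric]) (simp only: complex_norm_square mult.commute)
  finally have lim: "(\<lambda>n. LINT y|lborel. cnj (f y) * (LINT t|?N. f (y + \<sigma> n * t)))
    \<longlonglongrightarrow> complex_of_real (LINT y|lborel. (norm (f y))\<^sup>2)" .
  let ?w = "\<lambda>n \<omega>. (norm (I \<omega>))\<^sup>2 * exp (- (\<sigma> n * \<omega>)\<^sup>2 / 2)"
  have "complex_of_real (LINT \<omega>|lborel. ?w n \<omega>)
      = 2 * pi * (LINT y|lborel. cnj (f y) * (LINT t|?N. f (y + \<sigma> n * t)))" for n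
    unfolding integral_complex_of_real[symmetric] by (rule fourier_gaussian_weight[OF \<sigma>])
  then have "(\<lambda>n. complex_of_real (LINT \<omega>|lborel. ?w n \<omega>)) \<longlonglongrightarrow> 2 * pi * complex_of_real (LINT y|lborel. (norm (f y))\<^sup>2)"
    by (simp only:) (intro tendsto_intros lim)
  then have "(\<lambda>n. LINT \<omega>|lborel. ?w n \<omega>) \<longlonglongrightarrow> 2 * pi * (LINT y|lborel. (norm (f y))\<^sup>2)"
    by (simp only: tendsto_of_real_iff flip: of_real_mult)
  then have "(\<lambda>n. ennreal (LINT \<omega>|lborel. ?w n \<omega>)) \<longlonglongrightarrow> ennreal (2 * pi * (LINT y|lborel. (norm (f y))\<^sup>2))"
    by (rule tendsto_ennrealI)
  also have "(\<lambda>n. ennreal (LINT \<omega>|lborel. ?w n \<omega>)) = (\<lambda>n. \<integral>\<^sup>+\<omega>. ennreal (?w n \<omega>) \<partial>lborel)"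
  proof
    fix n
    \<comment> \<open>The damped integrand is dominated by a Gaussian, since the transform is
      bounded by the L^1 norm of \<open>f\<close>. This identifies its Bochner integral with its
      nonnegative integral, the only one available once the damping is removed.\<close>
    have "integrable lborel (\<lambda>\<omega>. std_normal_density (0 + \<sigma> n * \<omega>))"
      using \<sigma>[of n] by (intro lborel_integrable_real_affine) auto
    then have "integrable lborel (\<lambda>\<omega>. sqrt (2 * pi) * (LINT x|lborel. norm (f x))\<^sup>2 * std_normal_density (0 + \<sigma> n * \<omega>))"
      by (rule integrable_mult_right)
    then have "integrable lborel (?w n)"
    proof (rule Bochner_Integration.integrable_bound)
      show "AE \<omega> in lborel. norm (?w n \<omega>) \<le>
          norm (sqrt (2 * pi) * (LINT x|lborel. norm (f x))\<^sup>2 * std_normal_density (0 + \<sigma> n * \<omega>))"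
        using I_le by (intro AE_I2) (auto simp: std_normal_density_def abs_mult intro!: mult_right_mono power_mono)
    qed measurable
    then show "ennreal (LINT \<omega>|lborel. ?w n \<omega>) = (\<integral>\<^sup>+\<omega>. ennreal (?w n \<omega>) \<partial>lborel)"
      by (intro nn_integral_eq_integral[symmetric]) auto
  qed
  finally have lim1: "(\<lambda>n. \<integral>\<^sup>+\<omega>. ennreal (?w n \<omega>) \<partial>lborel) \<longlonglongrightarrow> ennreal (2 * pi * (LINT y|lborel. (norm (f y))\<^sup>2))" .
  have lim2: "(\<lambda>n. \<integral>\<^sup>+\<omega>. ennreal (?w n \<omega>) \<partial>lborel) \<longlonglongrightarrow> (\<integral>\<^sup>+\<omega>. ennreal ((norm (I \<omega>))\<^sup>2) \<partial>lborel)"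
  proof (rule nn_integral_LIMSEQ)
    show "incseq (\<lambda>n \<omega>. ennreal (?w n \<omega>))"
    proof (intro incseq_SucI le_funI ennreal_leI mult_left_mono)
      fix n \<omega>
      have "\<sigma> (Suc n) \<le> \<sigma> n" by (simp add: \<sigma>_def field_simps)
      then have "(\<sigma> (Suc n) * \<omega>)\<^sup>2 \<le> (\<sigma> n * \<omega>)\<^sup>2"
        using \<sigma>[of "Suc n"] unfolding power_mult_distrib by (intro mult_right_mono power_mono) auto
      then show "exp (- (\<sigma> n * \<omega>)\<^sup>2 / 2) \<le> exp (- (\<sigma> (Suc n) * \<omega>)\<^sup>2 / 2)" by simp
    qed simp
    fix \<omega>
    have "(\<lambda>n. ennreal (?w n \<omega>)) \<longlonglongrightarrow> ennreal ((norm (I \<omega>))\<^sup>2 * exp (- (0 * \<omega>)\<^sup>2 / 2))"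
      by (intro tendsto_intros \<sigma>_0) auto
    then show "(\<lambda>n. ennreal (?w n \<omega>)) \<longlonglongrightarrow> ennreal ((norm (I \<omega>))\<^sup>2)" by simp
  qed measurable
  \<comment> \<open>Bounded and integrable implies square integrable, so the limit found for the
    Bochner integrals is the intended nonnegative integral.\<close>
  have "integrable lborel (\<lambda>y. (norm (f y))\<^sup>2)"
  proof (rule Bochner_Integration.integrable_bound)
    show "integrable lborel (\<lambda>y. B * norm (f y))" using f by auto
    show "AE y in lborel. norm ((norm (f y))\<^sup>2) \<le> norm (B * norm (f y))"
      using f_le by (intro AE_I2) (auto simp: power2_eq_square abs_mult B_nonneg intro!: mult_right_mono)
  qed measurable
  then have "ennreal (2 * pi * (LINT y|lborel. (norm (f y))\<^sup>2))
      = ennreal (2 * pi) * (\<integral>\<^sup>+x. ennreal ((norm (f x))\<^sup>2) \<partial>lborel)"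
    by (subst nn_integral_eq_integral) (auto simp: ennreal_mult')
  with LIMSEQ_unique[OF lim1 lim2] show ?thesis by simp
qed

end

section \<open>The unitary Fourier integral\<close>

lemma fourier_integral_measurable [measurable]:
  assumes [measurable]: "f \<in> borel_measurable lborel"
  shows "fourier_integral f \<in> borel_measurable lborel"
  unfolding fourier_integral_def[abs_def] by measurable

lemma fourier_integral_diff:
  assumes "integrable lborel f" "integrable lborel g"
  shows "fourier_integral (\<lambda>x. f x - g x) \<omega> = fourier_integral f \<omega> - fourier_integral g \<omega>"
proof -
  have i: "integrable lborel (\<lambda>x. h x * exp (- (\<i> * complex_of_real (\<omega> * x))))"
    if h: "integrable lborel h" for h :: "real \<Rightarrow> complex"
    by (rule Bochner_Integration.integrable_bound[OF h])
      (use borel_measurable_integrable[OF h] in \<open>auto simp: norm_mult simp del: of_real_mult\<close>)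
  show ?thesis
    unfolding fourier_integral_def left_diff_distrib
    by (simp add: Bochner_Integration.integral_diff[OF i i] assms right_diff_distrib del: of_real_mult)
qed

theorem L2_norm_fourier_integral:
  assumes "integrable lborel f" "\<And>x. norm (f x) \<le> B" "AE x in lborel. isCont f x"
  shows "L2_norm (fourier_integral f) = L2_norm f"
proof -
  let ?I = "\<lambda>\<omega>. LINT x|lborel. f x * exp (- (\<i> * complex_of_real (\<omega> * x)))"
  have [measurable]: "f \<in> borel_measurable borel" using borel_measurable_integrable[OF assms(1)] by simp
  have "(\<integral>\<^sup>+\<omega>. ennreal ((norm (fourier_integral f \<omega>))\<^sup>2) \<partial>lborel)
      = (\<integral>\<^sup>+\<omega>. ennreal (1 / (2 * pi)) * ennreal ((norm (?I \<omega>))\<^sup>2) \<partial>lborel)"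
    by (intro nn_integral_cong)
      (auto simp: fourier_integral_def norm_mult norm_divide power_mult_distrib power_divide
         simp flip: ennreal_mult simp del: of_real_mult)
  also have "\<dots> = ennreal (1 / (2 * pi)) * (\<integral>\<^sup>+\<omega>. ennreal ((norm (?I \<omega>))\<^sup>2) \<partial>lborel)"
    by (rule nn_integral_cmult) measurable
  also have "\<dots> = (\<integral>\<^sup>+x. ennreal ((norm (f x))\<^sup>2) \<partial>lborel)"
    unfolding plancherel_integral[OF assms] mult.assoc[symmetric] by (simp flip: ennreal_mult)
  finally show ?thesis by (simp add: L2_norm_def)
qed

section \<open>Truncations and limits in the extended norm\<close>

abbreviation truncation :: "real \<Rightarrow> (real \<Rightarrow> complex) \<Rightarrow> real \<Rightarrow> complex" where
  "truncation R f \<equiv> \<lambda>x. indicat_real {-R..R} x *\<^sub>R f x"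

lemma tendsto_0_imp_le_ennreal:
  fixes a b :: ennreal
  assumes "F \<noteq> bot" "(e \<longlongrightarrow> 0) F" "\<forall>\<^sub>F i in F. a \<le> b + e i"
  shows "a \<le> b"
proof -
  have "((\<lambda>i. b + e i) \<longlongrightarrow> b + 0) F" by (intro tendsto_intros assms)
  then show ?thesis using tendsto_lowerbound[OF _ assms(3,1)] by simp
qed

lemma tendsto_0_sandwich_ennreal:
  fixes u v :: "'a \<Rightarrow> ennreal"
  assumes "(v \<longlongrightarrow> 0) F" "\<And>i. u i \<le> v i"
  shows "(u \<longlongrightarrow> 0) F"
  by (rule tendsto_sandwich[OF _ _ tendsto_const assms(1)]) (auto simp: assms(2))

lemma tendsto_0_of_power2_ennreal:
  fixes u :: "'a \<Rightarrow> ennreal"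
  assumes "((\<lambda>i. (u i)\<^sup>2) \<longlongrightarrow> 0) F"
  shows "(u \<longlongrightarrow> 0) F"
proof (rule order_tendstoI)
  fix a :: ennreal assume "0 < a"
  then have "0 < a\<^sup>2" by (simp add: zero_less_iff_neq_zero)
  from order_tendstoD(2)[OF assms this] show "\<forall>\<^sub>F i in F. u i < a"
    by eventually_elim (metis leD leI power_mono zero_le)
qed simp

lemma integrable_truncation:
  assumes [measurable]: "f \<in> borel_measurable lborel" and "\<And>x. norm (f x) \<le> B"
  shows "integrable lborel (truncation R f)"
proof (rule Bochner_Integration.integrable_bound)
  show "integrable lborel (\<lambda>x. indicat_real {-R..R} x * B)"
    by (intro integrable_mult_left integrable_real_indicator) (auto simp: emeasure_lborel_Icc_eq)
  show "AE x in lborel. norm (truncation R f x) \<le> norm (indicat_real {-R..R} x * B)"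
    by (intro AE_I2) (auto simp: indicator_def intro: order_trans[OF assms(2) abs_ge_self])
qed measurable

text \<open>Cutting creates at most the two new discontinuities -R and R, a null set, so Plancherel
  still applies to the truncated function.\<close>

lemma isCont_truncation:
  assumes "isCont f x" "x \<noteq> R" "x \<noteq> -R"
  shows "isCont (truncation R f) x"
proof (cases "\<bar>x\<bar> < R")
  case True
  then have "\<forall>\<^sub>F y in nhds x. y \<in> {-R<..<R}"
    by (intro eventually_nhds_in_open) auto
  then have "\<forall>\<^sub>F y in nhds x. truncation R f y = f y"
    by eventually_elim (auto simp: indicator_def)
  from isCont_cong[OF this] assms(1) show ?thesis by simp
next
  case False
  then have "x \<in> - {-R..R}" using assms by auto
  then have "\<forall>\<^sub>F y in nhds x. y \<in> - {-R..R}"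
    by (intro eventually_nhds_in_open) auto
  then have "\<forall>\<^sub>F y in nhds x. truncation R f y = 0"
    by eventually_elim (auto simp: indicator_def)
  from isCont_cong[OF this] show ?thesis by simp
qed

lemma L2_norm_truncation_le: "L2_norm (truncation R f) \<le> L2_norm f"
  unfolding L2_norm_def
  by (intro ennreal_sqrt_mono nn_integral_mono ennreal_leI power_mono) (auto simp: indicator_def)

text \<open>At each point the difference is eventually zero, and its square is dominated by that of
  \<open>f\<close>. Arbitrary sequences tending to infinity replace the real parameter, as dominated
  convergence is sequential.\<close>

lemma L2_norm_truncation_tendsto:
  assumes f: "in_L2 f"
  shows "((\<lambda>R. L2_norm (\<lambda>x. truncation R f x - f x)) \<longlongrightarrow> 0) at_top"
proof (rule tendsto_0_of_power2_ennreal, rule tendsto_at_topI_sequentially)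
  fix X :: "nat \<Rightarrow> real" assume X: "filterlim X at_top sequentially"
  have [measurable]: "f \<in> borel_measurable lborel" using f by (simp add: in_L2_def)
  have "(\<lambda>n. \<integral>\<^sup>+x. ennreal ((norm (truncation (X n) f x - f x))\<^sup>2) \<partial>lborel) \<longlonglongrightarrow> nn_integral lborel (\<lambda>x::real. 0)"
  proof (rule nn_integral_dominated_convergence[where w = "\<lambda>x. ennreal ((norm (f x))\<^sup>2)"])
    show "(\<integral>\<^sup>+x. ennreal ((norm (f x))\<^sup>2) \<partial>lborel) < \<infinity>"
      using f by (simp add: in_L2_def L2_norm_def)
    show "AE x in lborel. (\<lambda>n. ennreal ((norm (truncation (X n) f x - f x))\<^sup>2)) \<longlonglongrightarrow> 0"
    proof (rule AE_I2)
      fix x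
      have "\<forall>\<^sub>F n in sequentially. \<bar>x\<bar> \<le> X n"
        using X by (simp add: filterlim_at_top)
      then have "\<forall>\<^sub>F n in sequentially. ennreal ((norm (truncation (X n) f x - f x))\<^sup>2) = 0"
        by eventually_elim (auto simp: indicator_def abs_le_iff)
      then show "(\<lambda>n. ennreal ((norm (truncation (X n) f x - f x))\<^sup>2)) \<longlonglongrightarrow> 0"
        by (rule tendsto_eventually)
    qed
  qed (auto simp: indicator_def intro!: AE_I2 ennreal_leI power_mono)
  then show "(\<lambda>n. (L2_norm (\<lambda>x. truncation (X n) f x - f x))\<^sup>2) \<longlonglongrightarrow> 0"
    by (simp add: L2_norm_power2)
qed

lemma has_L2_fourierD:
  assumes "has_L2_fourier f g"
  shows "in_L2 f" "in_L2 g" "f \<in> borel_measurable lborel" "g \<in> borel_measurable lborel"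
  using assms by (simp_all add: has_L2_fourier_def in_L2_def)

text \<open>The bounds make all truncations integrable, where the Fourier integral is genuinely
  linear; the two errors then add up.\<close>

lemma has_L2_fourier_diff:
  assumes f: "has_L2_fourier f1 g1" "\<And>x. norm (f1 x) \<le> B1"
    and g: "has_L2_fourier f2 g2" "\<And>x. norm (f2 x) \<le> B2"
  shows "has_L2_fourier (\<lambda>x. f1 x - f2 x) (\<lambda>\<omega>. g1 \<omega> - g2 \<omega>)"
proof -
  note [measurable] = has_L2_fourierD(3,4)[OF f(1)] has_L2_fourierD(3,4)[OF g(1)]
  have in_L2: "in_L2 (\<lambda>x. u x - v x)" if "in_L2 u" "in_L2 v" for u v :: "real \<Rightarrow> complex"
    using that le_less_trans[OF L2_norm_triangle_diff[of u v]]
    by (auto simp: in_L2_def less_top)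
  have *: "fourier_integral (truncation R (\<lambda>x. f1 x - f2 x)) \<omega> =
      fourier_integral (truncation R f1) \<omega> - fourier_integral (truncation R f2) \<omega>" for R \<omega>
    by (subst fourier_integral_diff[symmetric])
      (auto intro!: integrable_truncation f g simp: scaleR_diff_right)
  have "((\<lambda>R. L2_norm (\<lambda>\<omega>. (g1 \<omega> - g2 \<omega>) - fourier_integral (truncation R (\<lambda>x. f1 x - f2 x)) \<omega>)) \<longlongrightarrow> 0) at_top"
  proof (rule tendsto_0_sandwich_ennreal)
    show "((\<lambda>R. L2_norm (\<lambda>\<omega>. g1 \<omega> - fourier_integral (truncation R f1) \<omega>)
        + L2_norm (\<lambda>\<omega>. g2 \<omega> - fourier_integral (truncation R f2) \<omega>)) \<longlongrightarrow> 0) at_top"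
      using tendsto_add[of _ "0::ennreal" at_top _ 0] assms by (auto simp: has_L2_fourier_def)
    fix R
    show "L2_norm (\<lambda>\<omega>. (g1 \<omega> - g2 \<omega>) - fourier_integral (truncation R (\<lambda>x. f1 x - f2 x)) \<omega>) \<le>
        L2_norm (\<lambda>\<omega>. g1 \<omega> - fourier_integral (truncation R f1) \<omega>)
        + L2_norm (\<lambda>\<omega>. g2 \<omega> - fourier_integral (truncation R f2) \<omega>)"
      unfolding *
      by (rule order_trans[OF eq_refl L2_norm_triangle_diff]) (auto intro!: arg_cong[where f = L2_norm])
  qed
  then show ?thesis using assms by (auto simp: has_L2_fourier_def intro!: in_L2)
qed

section \<open>The L^2 transform of bounded, almost everywhere continuous functions\<close>

context
  fixes f :: "real \<Rightarrow> complex" and B :: real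
  assumes L2: "in_L2 f" and f_le: "\<And>x. norm (f x) \<le> B" and cont: "AE x in lborel. isCont f x"
begin

private abbreviation "\<F> R \<equiv> fourier_integral (truncation R f)"

private lemma L2_measurable [measurable]: "f \<in> borel_measurable lborel"
  using L2 by (simp add: in_L2_def)

private lemma cont_truncation: "AE x in lborel. isCont (truncation R f) x"
  using cont AE_lborel_singleton[of R] AE_lborel_singleton[of "-R"]
  by eventually_elim (rule isCont_truncation)

private lemma norm_truncation: "norm (truncation R f x) \<le> B"
  using f_le[of x] order_trans[OF norm_ge_zero f_le[of x]] by (auto simp: indicator_def)

lemma L2_norm_fourier_truncation: "L2_norm (\<F> R) = L2_norm (truncation R f)"
  by (rule L2_norm_fourier_integral[OF integrable_truncation norm_truncation cont_truncation])
    (auto intro: f_le)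

text \<open>A Cauchy estimate: Plancherel applies to the difference of two truncations, which is
  small because both are close to \<open>f\<close>.\<close>

lemma L2_norm_fourier_truncation_diff:
  "L2_norm (\<lambda>\<omega>. \<F> R \<omega> - \<F> R' \<omega>) \<le>
    L2_norm (\<lambda>x. truncation R f x - f x) + L2_norm (\<lambda>x. truncation R' f x - f x)"
proof -
  have i: "integrable lborel (truncation R f)" for R
    by (rule integrable_truncation) (auto intro: f_le)
  have "L2_norm (\<lambda>\<omega>. \<F> R \<omega> - \<F> R' \<omega>) = L2_norm (fourier_integral (\<lambda>x. truncation R f x - truncation R' f x))"
    by (intro arg_cong[where f = L2_norm] ext fourier_integral_diff[OF i i, symmetric])
  also have "\<dots> = L2_norm (\<lambda>x. truncation R f x - truncation R' f x)"
  proof (rule L2_norm_fourier_integral)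
    show "norm (truncation R f x - truncation R' f x) \<le> B + B" for x
      by (rule order_trans[OF norm_triangle_ineq4 add_mono]) (rule norm_truncation)+
    show "AE x in lborel. isCont (\<lambda>x. truncation R f x - truncation R' f x) x"
      using cont_truncation[of R] cont_truncation[of R'] by eventually_elim (rule continuous_diff)
  qed (rule Bochner_Integration.integrable_diff[OF i i])
  also have "\<dots> = L2_norm (\<lambda>x. (truncation R f x - f x) - (truncation R' f x - f x))" by simp
  also have "\<dots> \<le> L2_norm (\<lambda>x. truncation R f x - f x) + L2_norm (\<lambda>x. truncation R' f x - f x)"
    by (rule L2_norm_triangle_diff) measurable
  finally show ?thesis .
qed

lemma has_L2_fourier_exists: "\<exists>g. has_L2_fourier f g"
proof -
  let ?e = "\<lambda>R. L2_norm (\<lambda>x. truncation R f x - f x)"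
  note lim = L2_norm_truncation_tendsto[OF L2]
  have lim_nat: "(\<lambda>n. ?e (real n)) \<longlonglongrightarrow> 0"
    by (rule filterlim_compose[OF lim filterlim_real_sequentially])
  obtain g where g [measurable]: "g \<in> borel_measurable lborel"
    and g_lim: "(\<lambda>n. L2_norm (\<lambda>\<omega>. g \<omega> - \<F> (real n) \<omega>)) \<longlonglongrightarrow> 0"
  proof (rule L2_complete[of "\<lambda>n. \<F> (real n)"])
    fix e :: real assume "e > 0"
    then have "0 < ennreal (e / 2)" by simp
    from order_tendstoD(2)[OF lim_nat this]
    obtain N where N: "\<And>n. n \<ge> N \<Longrightarrow> ?e (real n) < ennreal (e / 2)"
      by (auto simp: eventually_sequentially)
    have "L2_norm (\<lambda>x. \<F> (real m) x - \<F> (real n) x) \<le> ennreal e" if "m \<ge> N" "n \<ge> N" for m n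
    proof -
      have "L2_norm (\<lambda>x. \<F> (real m) x - \<F> (real n) x) \<le> ennreal (e / 2) + ennreal (e / 2)"
        using N that
        by (intro order_trans[OF L2_norm_fourier_truncation_diff] add_mono less_imp_le) auto
      also have "\<dots> = ennreal e" using \<open>e > 0\<close> by (simp flip: ennreal_plus)
      finally show ?thesis .
    qed
    then show "\<exists>N. \<forall>m\<ge>N. \<forall>n\<ge>N. L2_norm (\<lambda>x. \<F> (real m) x - \<F> (real n) x) \<le> ennreal e" by blast
  qed auto
  \<comment> \<open>Completeness only gives the limit along integers, while
    \<open>has_L2_fourier\<close> asks for real R. Passing through a large integer \<open>n\<close>
    bounds the error at every real R by the tail of \<open>f\<close> alone.\<close>
  have g_le: "L2_norm (\<lambda>\<omega>. g \<omega> - \<F> R \<omega>) \<le> ?e R" for R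
  proof (rule tendsto_0_imp_le_ennreal)
    show "(\<lambda>n. L2_norm (\<lambda>\<omega>. g \<omega> - \<F> (real n) \<omega>) + ?e (real n)) \<longlonglongrightarrow> 0"
      using tendsto_add[OF g_lim lim_nat] by simp
    show "\<forall>\<^sub>F n in sequentially. L2_norm (\<lambda>\<omega>. g \<omega> - \<F> R \<omega>)
        \<le> ?e R + (L2_norm (\<lambda>\<omega>. g \<omega> - \<F> (real n) \<omega>) + ?e (real n))"
    proof (rule always_eventually, rule allI)
      fix n :: nat
      have "L2_norm (\<lambda>\<omega>. g \<omega> - \<F> R \<omega>) = L2_norm (\<lambda>\<omega>. (g \<omega> - \<F> (real n) \<omega>) + (\<F> (real n) \<omega> - \<F> R \<omega>))"
        by simp
      also have "\<dots> \<le> L2_norm (\<lambda>\<omega>. g \<omega> - \<F> (real n) \<omega>) + L2_norm (\<lambda>\<omega>. \<F> (real n) \<omega> - \<F> R \<omega>)"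
        by (rule L2_norm_triangle) measurable
      also have "\<dots> \<le> L2_norm (\<lambda>\<omega>. g \<omega> - \<F> (real n) \<omega>) + (?e (real n) + ?e R)"
        by (intro add_left_mono L2_norm_fourier_truncation_diff)
      finally show "L2_norm (\<lambda>\<omega>. g \<omega> - \<F> R \<omega>)
        \<le> ?e R + (L2_norm (\<lambda>\<omega>. g \<omega> - \<F> (real n) \<omega>) + ?e (real n))"
        by (simp add: ac_simps)
    qed
  qed simp
  have g_lim': "((\<lambda>R. L2_norm (\<lambda>\<omega>. g \<omega> - \<F> R \<omega>)) \<longlongrightarrow> 0) at_top"
    by (rule tendsto_0_sandwich_ennreal[OF lim g_le])
  \<comment> \<open>One R with finite error is enough to make the norm of \<open>g\<close>
    finite.\<close>
  have "\<forall>\<^sub>F R in at_top. L2_norm (\<lambda>\<omega>. g \<omega> - \<F> R \<omega>) < \<top>"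
    by (rule order_tendstoD(2)[OF g_lim']) simp
  then obtain R where R: "L2_norm (\<lambda>\<omega>. g \<omega> - \<F> R \<omega>) < \<top>"
    by (auto simp: eventually_at_top_linorder)
  have "L2_norm g = L2_norm (\<lambda>\<omega>. (g \<omega> - \<F> R \<omega>) + \<F> R \<omega>)" by simp
  also have "\<dots> \<le> L2_norm (\<lambda>\<omega>. g \<omega> - \<F> R \<omega>) + L2_norm (\<F> R)"
    by (rule L2_norm_triangle) measurable
  also have "\<dots> \<le> L2_norm (\<lambda>\<omega>. g \<omega> - \<F> R \<omega>) + L2_norm f"
    unfolding L2_norm_fourier_truncation by (intro add_left_mono L2_norm_truncation_le)
  also have "\<dots> < \<top>" using R L2 by (simp add: in_L2_def)
  finally have "in_L2 g" by (simp add: in_L2_def)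
  with g_lim' L2 show ?thesis unfolding has_L2_fourier_def by auto
qed

lemma has_L2_fourier_L2_fourier: "has_L2_fourier f (L2_fourier f)"
  unfolding L2_fourier_def using has_L2_fourier_exists by (rule someI_ex)

text \<open>Isometry is inherited from the truncations, which approximate \<open>f\<close> on one
  side and whose transforms approximate \<open>g\<close> on the other.\<close>

theorem L2_norm_has_L2_fourier:
  assumes g: "has_L2_fourier f g"
  shows "L2_norm g = L2_norm f"
proof (rule antisym)
  have [measurable]: "g \<in> borel_measurable lborel"
    and lim: "((\<lambda>R. L2_norm (\<lambda>\<omega>. g \<omega> - \<F> R \<omega>)) \<longlongrightarrow> 0) at_top"
    using g by (auto simp: has_L2_fourier_def in_L2_def)
  have "L2_norm g \<le> L2_norm f + L2_norm (\<lambda>\<omega>. g \<omega> - \<F> R \<omega>)" for R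
  proof -
    have "L2_norm g = L2_norm (\<lambda>\<omega>. \<F> R \<omega> + (g \<omega> - \<F> R \<omega>))" by simp
    also have "\<dots> \<le> L2_norm (\<F> R) + L2_norm (\<lambda>\<omega>. g \<omega> - \<F> R \<omega>)"
      by (rule L2_norm_triangle) measurable
    also have "\<dots> \<le> L2_norm f + L2_norm (\<lambda>\<omega>. g \<omega> - \<F> R \<omega>)"
      unfolding L2_norm_fourier_truncation by (intro add_right_mono L2_norm_truncation_le)
    finally show ?thesis .
  qed
  then show "L2_norm g \<le> L2_norm f"
    by (intro tendsto_0_imp_le_ennreal[OF _ lim]) auto
  have lim2: "((\<lambda>R. L2_norm (\<lambda>\<omega>. g \<omega> - \<F> R \<omega>) + L2_norm (\<lambda>x. truncation R f x - f x)) \<longlongrightarrow> 0) at_top"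
    using tendsto_add[OF lim L2_norm_truncation_tendsto[OF L2]] by simp
  have "L2_norm f \<le> L2_norm g + (L2_norm (\<lambda>\<omega>. g \<omega> - \<F> R \<omega>) + L2_norm (\<lambda>x. truncation R f x - f x))" for R
  proof -
    have "L2_norm f = L2_norm (\<lambda>x. truncation R f x - (truncation R f x - f x))" by simp
    also have "\<dots> \<le> L2_norm (truncation R f) + L2_norm (\<lambda>x. truncation R f x - f x)"
      by (rule L2_norm_triangle_diff) measurable
    also have "L2_norm (truncation R f) = L2_norm (\<lambda>\<omega>. g \<omega> - (g \<omega> - \<F> R \<omega>))"
      by (simp add: L2_norm_fourier_truncation)
    also have "\<dots> \<le> L2_norm g + L2_norm (\<lambda>\<omega>. g \<omega> - \<F> R \<omega>)"
      by (rule L2_norm_triangle_diff) measurable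
    finally show ?thesis by (simp add: ac_simps add_left_mono)
  qed
  then show "L2_norm f \<le> L2_norm g"
    by (intro tendsto_0_imp_le_ennreal[OF _ lim2]) auto
qed

end

section \<open>Spectral norms and the Cramer distance\<close>

text \<open>For antitone families the limit at 0 is a supremum. In this form it commutes with the
  supremum over state-action pairs and is visibly unique.\<close>

lemma increases_to_at_0_iff:
  "increases_to_at_0 f l \<longleftrightarrow> antimono_on {0<..} f \<and> l = (SUP \<epsilon>\<in>{0<..}. f \<epsilon>)"
proof -
  have "(f \<longlongrightarrow> (SUP \<epsilon>\<in>{0<..}. f \<epsilon>)) (at_right 0)" if f: "antimono_on {0<..} f"
  proof (rule increasing_tendsto)
    show "\<forall>\<^sub>F \<epsilon> in at_right 0. f \<epsilon> \<le> (SUP \<epsilon>\<in>{0<..}. f \<epsilon>)"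
      using eventually_at_right_less[of 0] by eventually_elim (auto intro: SUP_upper)
    fix x assume "x < (SUP \<epsilon>\<in>{0<..}. f \<epsilon>)"
    then obtain \<delta> where "\<delta> > 0" "x < f \<delta>" by (auto simp: less_SUP_iff)
    then show "\<forall>\<^sub>F \<epsilon> in at_right 0. x < f \<epsilon>"
      unfolding eventually_at_right[OF zero_less_one]
      using f by (intro bexI[of _ \<delta>] exI[of _ \<delta>])
        (auto simp: monotone_on_def intro: less_le_trans)
  qed
  then show ?thesis
    unfolding increases_to_at_0_def
    using tendsto_unique[OF trivial_limit_at_right_real, of f] by blast
qed

lemma Heps_norm_diff_abs_spectral:
  assumes "f \<in> borel_measurable lborel" "g \<in> borel_measurable lborel"
  shows "Heps_norm \<epsilon> (abs_spectral f - abs_spectral g) = ennreal_sqrt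
    (ennreal (1 / (2 * pi)) * (\<integral>\<^sup>+\<omega>. ennreal ((cmod (f \<omega> - g \<omega>))\<^sup>2 / (\<omega>\<^sup>2 + \<epsilon>)) \<partial>lborel))"
  using assms by (simp add: minus_spectral.abs_eq Heps_norm.abs_eq)

lemma increases_to_at_0_nn_integral_weight:
  fixes h :: "real \<Rightarrow> 'b::real_normed_vector"
  assumes [measurable]: "h \<in> borel_measurable lborel"
  shows "increases_to_at_0
    (\<lambda>\<epsilon>. ennreal_sqrt (\<integral>\<^sup>+\<omega>. ennreal (\<omega>\<^sup>2 / (\<omega>\<^sup>2 + \<epsilon>) * (norm (h \<omega>))\<^sup>2) \<partial>lborel)) (L2_norm h)"
    (is "increases_to_at_0 ?N _")
  unfolding increases_to_at_0_iff
proof (intro conjI antisym)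
  have mono: "\<omega>\<^sup>2 / (\<omega>\<^sup>2 + \<delta>) \<le> \<omega>\<^sup>2 / (\<omega>\<^sup>2 + \<epsilon>)" if "0 < \<epsilon>" "\<epsilon> \<le> \<delta>" for \<omega> \<epsilon> \<delta> :: real
    using that by (intro divide_left_mono mult_pos_pos add_nonneg_pos) auto
  then show "antimono_on {0<..} ?N"
    by (intro monotone_onI ennreal_sqrt_mono nn_integral_mono ennreal_leI mult_right_mono) auto
  show "(SUP \<epsilon>\<in>{0<..}. ?N \<epsilon>) \<le> L2_norm h"
    unfolding L2_norm_def
    by (intro SUP_least ennreal_sqrt_mono nn_integral_mono ennreal_leI mult_left_le_one_le)
      (auto simp: divide_le_eq_1 add_nonneg_pos)
  \<comment> \<open>A single sequence tending to 0 suffices, since each of its terms is below the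
    supremum over all positive parameters.\<close>
  define \<epsilon> :: "nat \<Rightarrow> real" where "\<epsilon> n = 1 / real (Suc n)" for n
  have \<epsilon>: "\<epsilon> n > 0" for n by (simp add: \<epsilon>_def)
  have \<epsilon>_0: "\<epsilon> \<longlonglongrightarrow> 0"
    unfolding \<epsilon>_def[abs_def] using LIMSEQ_inverse_real_of_nat by (simp add: inverse_eq_divide)
  \<comment> \<open>At frequency 0 the weight is 0 for every parameter and does not tend to 1. The
    limit function records this, and the point is removed as a null set afterwards.\<close>
  have "(\<lambda>n. \<integral>\<^sup>+\<omega>. ennreal (\<omega>\<^sup>2 / (\<omega>\<^sup>2 + \<epsilon> n) * (norm (h \<omega>))\<^sup>2) \<partial>lborel)
      \<longlonglongrightarrow> (\<integral>\<^sup>+\<omega>. ennreal (if \<omega> = 0 then 0 else (norm (h \<omega>))\<^sup>2) \<partial>lborel)"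
  proof (rule nn_integral_LIMSEQ)
    show "incseq (\<lambda>n \<omega>. ennreal (\<omega>\<^sup>2 / (\<omega>\<^sup>2 + \<epsilon> n) * (norm (h \<omega>))\<^sup>2))"
      by (intro incseq_SucI le_funI ennreal_leI mult_right_mono mono \<epsilon>) (auto simp: \<epsilon>_def field_simps)
    fix \<omega> :: real
    show "(\<lambda>n. ennreal (\<omega>\<^sup>2 / (\<omega>\<^sup>2 + \<epsilon> n) * (norm (h \<omega>))\<^sup>2))
        \<longlonglongrightarrow> ennreal (if \<omega> = 0 then 0 else (norm (h \<omega>))\<^sup>2)"
    proof (cases "\<omega> = 0")
      case False
      then have "(\<lambda>n. ennreal (\<omega>\<^sup>2 / (\<omega>\<^sup>2 + \<epsilon> n) * (norm (h \<omega>))\<^sup>2))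
          \<longlonglongrightarrow> ennreal (\<omega>\<^sup>2 / (\<omega>\<^sup>2 + 0) * (norm (h \<omega>))\<^sup>2)"
        by (intro tendsto_intros \<epsilon>_0) auto
      then show ?thesis using False by simp
    qed simp
  qed measurable
  moreover have "(\<integral>\<^sup>+\<omega>. ennreal (if \<omega> = 0 then 0 else (norm (h \<omega>))\<^sup>2) \<partial>lborel) = (L2_norm h)\<^sup>2"
    unfolding L2_norm_power2 using AE_lborel_singleton[of 0]
    by (intro nn_integral_cong_AE, eventually_elim) simp
  ultimately have lim: "(\<lambda>n. \<integral>\<^sup>+\<omega>. ennreal (\<omega>\<^sup>2 / (\<omega>\<^sup>2 + \<epsilon> n) * (norm (h \<omega>))\<^sup>2) \<partial>lborel) \<longlonglongrightarrow> (L2_norm h)\<^sup>2"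
    by simp
  have "(L2_norm h)\<^sup>2 \<le> (SUP \<epsilon>\<in>{0<..}. ?N \<epsilon>)\<^sup>2"
  proof (rule LIMSEQ_le_const2[OF lim], intro exI allI impI)
    fix n
    have "?N (\<epsilon> n) \<le> (SUP \<epsilon>\<in>{0<..}. ?N \<epsilon>)"
      using \<epsilon> by (intro SUP_upper) auto
    then show "(\<integral>\<^sup>+\<omega>. ennreal (\<omega>\<^sup>2 / (\<omega>\<^sup>2 + \<epsilon> n) * (norm (h \<omega>))\<^sup>2) \<partial>lborel) \<le> (SUP \<epsilon>\<in>{0<..}. ?N \<epsilon>)\<^sup>2"
      unfolding ennreal_sqrt_le_iff .
  qed
  then have "ennreal_sqrt ((L2_norm h)\<^sup>2) \<le> (SUP \<epsilon>\<in>{0<..}. ?N \<epsilon>)"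
    unfolding ennreal_sqrt_le_iff .
  then show "L2_norm h \<le> (SUP \<epsilon>\<in>{0<..}. ?N \<epsilon>)" by simp
qed

section \<open>Spectral transport of CDFs\<close>

abbreviation cdf_shift :: "real measure \<Rightarrow> real \<Rightarrow> complex" where
  "cdf_shift P \<equiv> \<lambda>x. complex_of_real (cdf P x - cdf_delta0 x)"

lemma norm_cdf_shift_le:
  assumes "real_distribution P"
  shows "norm (cdf_shift P x) \<le> 1"
  unfolding norm_of_real
  using real_distribution.cdf_bounded_prob[OF assms, of x] finite_borel_measure.cdf_nonneg[of P x] assms
  by (auto simp: cdf_delta0_eq real_distribution.finite_borel_measure_M abs_le_iff)

lemma AE_isCont_cdf:
  assumes "real_distribution P"
  shows "AE x in lborel. isCont (cdf P) x"
proof -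
  have "mono (cdf P)"
    by (intro monoI finite_borel_measure.cdf_nondecreasing real_distribution.finite_borel_measure_M assms)
  then have "{x. \<not> isCont (cdf P) x} \<in> null_sets lborel"
    by (intro countable_imp_null_set_lborel mono_ctble_discont)
  then show ?thesis by (rule AE_I') auto
qed

lemma AE_isCont_cdf_shift:
  assumes "real_distribution P"
  shows "AE x in lborel. isCont (cdf_shift P) x"
proof -
  have "real_distribution (return borel 0)"
    by (intro real_distribution.intro prob_space_return real_distribution_axioms.intro) auto
  from AE_isCont_cdf[OF assms] AE_isCont_cdf[OF this] show ?thesis
    by eventually_elim (intro continuous_intros)
qed

lemma in_L2_cdf_shift:
  assumes "cdf P \<in> Gamma_F"
  shows "in_L2 (cdf_shift P)"
proof -
  have "in_L2 (\<lambda>x. cdf P x - cdf_delta0 x)"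
    using assms by (auto simp: Gamma_F_def)
  then show ?thesis
    unfolding in_L2_def L2_norm_def norm_of_real by (auto simp del: of_real_diff)
qed

text \<open>The shift by F_{delta_0} makes each transform exist separately and cancels in the
  difference, so the limit involves only F_P - F_Q.\<close>

lemma Heps_norm_V_map_diff_increases:
  assumes P: "real_distribution P" "cdf P \<in> Gamma_F"
    and Q: "real_distribution Q" "cdf Q \<in> Gamma_F"
  shows "increases_to_at_0 (\<lambda>\<epsilon>. Heps_norm \<epsilon> (V_map (cdf P) - V_map (cdf Q))) (cramer_dist P Q)"
proof -
  let ?p = "L2_fourier (cdf_shift P)" and ?q = "L2_fourier (cdf_shift Q)"
  define h where "h \<omega> = ?p \<omega> - ?q \<omega>" for \<omega>
  have p: "has_L2_fourier (cdf_shift P) ?p"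
    by (rule has_L2_fourier_L2_fourier[OF in_L2_cdf_shift[OF P(2)] norm_cdf_shift_le[OF P(1)] AE_isCont_cdf_shift[OF P(1)]])
  have q: "has_L2_fourier (cdf_shift Q) ?q"
    by (rule has_L2_fourier_L2_fourier[OF in_L2_cdf_shift[OF Q(2)] norm_cdf_shift_le[OF Q(1)] AE_isCont_cdf_shift[OF Q(1)]])
  note [measurable] = has_L2_fourierD(4)[OF p] has_L2_fourierD(4)[OF q]
  have "has_L2_fourier (\<lambda>x. cdf_shift P x - cdf_shift Q x) h"
    unfolding h_def by (rule has_L2_fourier_diff[OF p norm_cdf_shift_le q norm_cdf_shift_le]) fact+
  then have "L2_norm h = L2_norm (\<lambda>x. cdf_shift P x - cdf_shift Q x)"
  proof (rule L2_norm_has_L2_fourier[rotated 3])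
    show "in_L2 (\<lambda>x. cdf_shift P x - cdf_shift Q x)"
      by (rule has_L2_fourierD(1)) fact
    show "norm (cdf_shift P x - cdf_shift Q x) \<le> 1 + 1" for x
      by (rule order_trans[OF norm_triangle_ineq4 add_mono]) (intro norm_cdf_shift_le P Q)+
    show "AE x in lborel. isCont (\<lambda>x. cdf_shift P x - cdf_shift Q x) x"
      using AE_isCont_cdf_shift[OF P(1)] AE_isCont_cdf_shift[OF Q(1)] by eventually_elim (rule continuous_diff)
  qed
  also have "\<dots> = L2_norm (\<lambda>x. complex_of_real (cdf P x - cdf Q x))"
    by simp
  also have "\<dots> = cramer_dist P Q"
    unfolding cramer_dist_def L2_norm_def norm_of_real by simp
  finally have h: "L2_norm h = cramer_dist P Q" .
  have cnj: "cnj \<in> borel_measurable borel"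
    by (intro borel_measurable_continuous_onI continuous_on_cnj continuous_on_id)
  have V: "(\<lambda>\<omega>. - complex_of_real (sqrt (2 * pi)) * \<i> * complex_of_real \<omega> * cnj (g \<omega>)) \<in> borel_measurable lborel"
    if "g \<in> borel_measurable lborel" for g
    using measurable_compose[OF that cnj] by measurable
  have "Heps_norm \<epsilon> (V_map (cdf P) - V_map (cdf Q)) =
      ennreal_sqrt (\<integral>\<^sup>+\<omega>. ennreal (\<omega>\<^sup>2 / (\<omega>\<^sup>2 + \<epsilon>) * (norm (h \<omega>))\<^sup>2) \<partial>lborel)" for \<epsilon>
  proof -
    have [measurable]: "h \<in> borel_measurable lborel" unfolding h_def[abs_def] by measurable
    \<comment> \<open>The multiplier \<omega> of \<open>V_map\<close> supplies the numerator of the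
      weight, and sqrt(2 pi) supplies the constant that cancels against the norm.\<close>
    have "(cmod (- complex_of_real (sqrt (2 * pi)) * \<i> * complex_of_real \<omega> * cnj (?p \<omega>)
        - (- complex_of_real (sqrt (2 * pi)) * \<i> * complex_of_real \<omega> * cnj (?q \<omega>))))\<^sup>2 / (\<omega>\<^sup>2 + \<epsilon>)
      = 2 * pi * (\<omega>\<^sup>2 / (\<omega>\<^sup>2 + \<epsilon>) * (norm (h \<omega>))\<^sup>2)" for \<omega>
    proof -
      have "- complex_of_real (sqrt (2 * pi)) * \<i> * complex_of_real \<omega> * cnj (?p \<omega>)
          - (- complex_of_real (sqrt (2 * pi)) * \<i> * complex_of_real \<omega> * cnj (?q \<omega>))
        = - complex_of_real (sqrt (2 * pi)) * \<i> * complex_of_real \<omega> * cnj (h \<omega>)"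
        by (simp add: h_def algebra_simps)
      then show ?thesis
        by (simp only: norm_mult norm_minus_cancel norm_of_real norm_ii complex_mod_cnj power_mult_distrib)
          simp
    qed
    then have "Heps_norm \<epsilon> (V_map (cdf P) - V_map (cdf Q)) = ennreal_sqrt (ennreal (1 / (2 * pi)) *
        (\<integral>\<^sup>+\<omega>. ennreal (2 * pi * (\<omega>\<^sup>2 / (\<omega>\<^sup>2 + \<epsilon>) * (norm (h \<omega>))\<^sup>2)) \<partial>lborel))"
      unfolding V_map_def Heps_norm_diff_abs_spectral[OF V[OF has_L2_fourierD(4)[OF p]] V[OF has_L2_fourierD(4)[OF q]]]
      by (simp only:)
    also have "(\<integral>\<^sup>+\<omega>. ennreal (2 * pi * (\<omega>\<^sup>2 / (\<omega>\<^sup>2 + \<epsilon>) * (norm (h \<omega>))\<^sup>2)) \<partial>lborel)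
        = (\<integral>\<^sup>+\<omega>. ennreal (2 * pi) * ennreal (\<omega>\<^sup>2 / (\<omega>\<^sup>2 + \<epsilon>) * (norm (h \<omega>))\<^sup>2) \<partial>lborel)"
      by (intro nn_integral_cong ennreal_mult') simp
    also have "\<dots> = ennreal (2 * pi) * (\<integral>\<^sup>+\<omega>. ennreal (\<omega>\<^sup>2 / (\<omega>\<^sup>2 + \<epsilon>) * (norm (h \<omega>))\<^sup>2) \<partial>lborel)"
      by (rule nn_integral_cmult) measurable
    finally show ?thesis
      unfolding mult.assoc[symmetric] by (simp flip: ennreal_mult)
  qed
  moreover have "h \<in> borel_measurable lborel" unfolding h_def[abs_def] by measurable
  ultimately show ?thesis
    using increases_to_at_0_nn_integral_weight[of h] by (simp only: h)
qed

text \<open>By right continuity, a disagreement at one point persists on an interval to its right,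
  which has positive measure.\<close>

lemma cdf_eqI_AE:
  assumes P: "real_distribution P" and Q: "real_distribution Q"
    and eq: "AE x in lborel. cdf P x = cdf Q x"
  shows "cdf P = cdf Q"
proof (rule ext, rule ccontr)
  fix x assume "cdf P x \<noteq> cdf Q x"
  moreover have "((\<lambda>y. cdf P y - cdf Q y) \<longlongrightarrow> cdf P x - cdf Q x) (at_right x)"
    using finite_borel_measure.cdf_is_right_cont[OF real_distribution.finite_borel_measure_M, of _ x] P Q
    by (auto simp: continuous_within intro!: tendsto_diff)
  ultimately have "\<forall>\<^sub>F y in at_right x. cdf P y - cdf Q y \<noteq> 0"
    by (intro tendsto_imp_eventually_ne) auto
  then obtain b where b: "b > x" "\<And>y. x < y \<Longrightarrow> y < b \<Longrightarrow> cdf P y \<noteq> cdf Q y"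
    unfolding eventually_at_right[OF less_add_one] by auto
  from eq have "AE y in lborel. y \<notin> {x<..<b}"
    by eventually_elim (use b in auto)
  then have "{x<..<b} \<in> null_sets lborel"
    by (subst AE_iff_null_sets) auto
  then show False using b by (simp add: null_sets_def)
qed

text \<open>If the images agree, the pairs (P, Q) and (P, P) have the same family of regularised
  norms, hence the same limit, which is 0 for the second pair.\<close>

lemma V_map_cdf_inject:
  assumes P: "real_distribution P" "cdf P \<in> Gamma_F"
    and Q: "real_distribution Q" "cdf Q \<in> Gamma_F"
    and eq: "V_map (cdf P) = V_map (cdf Q)"
  shows "cdf P = cdf Q"
proof (rule cdf_eqI_AE[OF P(1) Q(1)])
  have "cramer_dist P Q = cramer_dist P P"
    using Heps_norm_V_map_diff_increases[OF P Q] Heps_norm_V_map_diff_increases[OF P P]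
    by (simp add: increases_to_at_0_iff eq)
  also have "\<dots> = 0" by (simp add: cramer_dist_def L2_norm_def ennreal_sqrt_def)
  finally have "L2_norm (\<lambda>x. cdf P x - cdf Q x) = 0" by (simp add: cramer_dist_def)
  moreover have "cdf P \<in> borel_measurable borel" "cdf Q \<in> borel_measurable borel"
    using P Q by (auto intro!: borel_measurable_mono monoI finite_borel_measure.cdf_nondecreasing
        real_distribution.finite_borel_measure_M)
  ultimately have "AE x in lborel. cdf P x - cdf Q x = 0"
    by (subst (asm) L2_norm_eq_0_iff) auto
  then show "AE x in lborel. cdf P x = cdf Q x" by simp
qed

section \<open>Fields over state-action pairs\<close>

lemma X_cdfE:
  assumes "F \<in> X_cdf D" "sa \<in> D"
  obtains P where "real_distribution P" "cdf P \<in> Gamma_F" "F sa = cdf P"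
  using assms by (auto simp: X_cdf_def cdf_field_def)

text \<open>Needed for \<open>V_field_inv\<close> to return the original CDF field. Extensionality
  on \<open>D\<close> settles the values outside \<open>D\<close>.\<close>

lemma inj_on_V_field: "inj_on (V_field D) (X_cdf D)"
proof (rule inj_onI)
  fix F G assume F: "F \<in> X_cdf D" and G: "G \<in> X_cdf D" and eq: "V_field D F = V_field D G"
  show "F = G"
  proof (rule extensionalityI[of _ D])
    show "F \<in> extensional D" "G \<in> extensional D"
      using F G by (auto simp: X_cdf_def cdf_field_def)
    fix sa assume sa: "sa \<in> D"
    with eq have "V_map (F sa) = V_map (G sa)" by (auto simp: V_field_def dest: fun_cong[of _ _ sa])
    then show "F sa = G sa"
      using X_cdfE[OF F sa] X_cdfE[OF G sa] V_map_cdf_inject by metis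
  qed
qed

text \<open>Convergence need not be uniform over \<open>D\<close>. Exchanging the two suprema avoids
  this question and also covers infinite distances.\<close>

lemma d_Cr_reg_increases:
  assumes "\<mu>\<^sub>1 \<in> X_adm D" "\<mu>\<^sub>2 \<in> X_adm D"
  shows "increases_to_at_0 (\<lambda>\<epsilon>. d_Cr_reg D \<epsilon> \<mu>\<^sub>1 \<mu>\<^sub>2) (d_Cr_adm D \<mu>\<^sub>1 \<mu>\<^sub>2)"
proof -
  from assms obtain F G where F: "F \<in> X_cdf D" "\<mu>\<^sub>1 = V_field D F" and G: "G \<in> X_cdf D" "\<mu>\<^sub>2 = V_field D G"
    by (auto simp: X_adm_def)
  let ?N = "\<lambda>\<epsilon> sa. Heps_norm \<epsilon> (\<mu>\<^sub>1 sa - \<mu>\<^sub>2 sa)"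
  have inc: "increases_to_at_0 (\<lambda>\<epsilon>. ?N \<epsilon> sa) (L2_norm (\<lambda>x. F sa x - G sa x))" if sa: "sa \<in> D" for sa
  proof -
    obtain P where P: "real_distribution P" "cdf P \<in> Gamma_F" "F sa = cdf P"
      using X_cdfE[OF F(1) sa] .
    obtain Q where Q: "real_distribution Q" "cdf Q \<in> Gamma_F" "G sa = cdf Q"
      using X_cdfE[OF G(1) sa] .
    show ?thesis
      using Heps_norm_V_map_diff_increases[OF P(1,2) Q(1,2)] sa
      by (simp add: F G V_field_def P(3) Q(3) cramer_dist_def)
  qed
  have "d_Cr_adm D \<mu>\<^sub>1 \<mu>\<^sub>2 = (SUP sa\<in>D. L2_norm (\<lambda>x. F sa x - G sa x))"
    using F G by (simp add: d_Cr_adm_def d_Cr_def V_field_inv_def the_inv_into_f_f[OF inj_on_V_field])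
  also have "\<dots> = (SUP sa\<in>D. SUP \<epsilon>\<in>{0<..}. ?N \<epsilon> sa)"
    using inc by (intro SUP_cong) (auto simp: increases_to_at_0_iff)
  also have "\<dots> = (SUP \<epsilon>\<in>{0<..}. SUP sa\<in>D. ?N \<epsilon> sa)"
    by (rule SUP_commute)
  finally have "d_Cr_adm D \<mu>\<^sub>1 \<mu>\<^sub>2 = (SUP \<epsilon>\<in>{0<..}. d_Cr_reg D \<epsilon> \<mu>\<^sub>1 \<mu>\<^sub>2)"
    by (simp add: d_Cr_reg_def)
  moreover have "antimono_on {0<..} (\<lambda>\<epsilon>. d_Cr_reg D \<epsilon> \<mu>\<^sub>1 \<mu>\<^sub>2)"
    unfolding d_Cr_reg_def
    using inc by (intro monotone_onI SUP_subset_mono order_refl) (auto simp: increases_to_at_0_iff monotone_on_def)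
  ultimately show ?thesis by (simp add: increases_to_at_0_iff)
qed

theorem theorem35:
  fixes \<S> :: "'s measure" and \<A> :: "'a measure" and \<gamma> :: real
    and kern :: "'s \<times> 'a \<Rightarrow> 's measure" and rew :: "'s \<times> 'a \<Rightarrow> 's \<Rightarrow> real"
    and pol :: "'s \<Rightarrow> 'a measure"
  defines "D \<equiv> space (\<S> \<Otimes>\<^sub>M \<A>)"
    and "Z\<^sub>\<pi> \<equiv> return_law \<S> \<A> \<gamma> kern rew pol"
  defines "\<mu>\<^sub>\<pi> \<equiv> V_field D (cdf_field D Z\<^sub>\<pi>)"
  assumes mdp: "mdp \<S> \<A> \<gamma> kern rew pol"
    and bounded_rewards: "\<exists>R_max. \<forall>sa\<in>D. AE s' in kern sa. \<bar>rew sa s'\<bar> \<le> R_max"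
    and measurable_expectations: "\<forall>F\<in>X_cdf D. \<forall>x.
      (\<lambda>sa. LINT sa'|pol_trans \<S> \<A> kern pol sa. F sa' x) \<in> borel_measurable (\<S> \<Otimes>\<^sub>M \<A>)"
    and return_in_Gamma: "\<forall>sa\<in>D. cdf (Z\<^sub>\<pi> sa) \<in> Gamma_F"
  shows "(\<forall>sa\<in>D. \<forall>P. real_distribution P \<and> cdf P \<in> Gamma_F \<longrightarrow>
            increases_to_at_0 (\<lambda>\<epsilon>. Heps_norm \<epsilon> (\<mu>\<^sub>\<pi> sa - V_map (cdf P))) (cramer_dist (Z\<^sub>\<pi> sa) P))
       \<and> (\<forall>\<mu>\<^sub>1\<in>X_adm D. \<forall>\<mu>\<^sub>2\<in>X_adm D.
            increases_to_at_0 (\<lambda>\<epsilon>. d_Cr_reg D \<epsilon> \<mu>\<^sub>1 \<mu>\<^sub>2) (d_Cr_adm D \<mu>\<^sub>1 \<mu>\<^sub>2))"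
proof (intro conjI ballI allI impI)
  fix sa P assume sa: "sa \<in> D" and P: "real_distribution P \<and> cdf P \<in> Gamma_F"
  \<comment> \<open>The measurable kernels and rewards of the MDP make the return law a genuine
    probability law, as the single-pair result demands of both of its arguments.\<close>
  have "real_distribution (Z\<^sub>\<pi> sa)"
    unfolding Z\<^sub>\<pi>_def using sa by (intro mdp.real_distribution_return_law[OF mdp]) (simp add: D_def)
  from Heps_norm_V_map_diff_increases[OF this _ conjunct1[OF P] conjunct2[OF P]] return_in_Gamma sa
  show "increases_to_at_0 (\<lambda>\<epsilon>. Heps_norm \<epsilon> (\<mu>\<^sub>\<pi> sa - V_map (cdf P))) (cramer_dist (Z\<^sub>\<pi> sa) P)"
    by (simp add: \<mu>\<^sub>\<pi>_def V_field_def cdf_field_def)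
qed (rule d_Cr_reg_increases)

end
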